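(* Let $n\geq 4$, let \[ G=H_{2^n}=\langle a,b,c\mid a^{2^{n-2}}=b^2=c^2=1,\ (a,b)=c,\ (a,c)=(b,c)=1\rangle, \] and let $F$ be a finite field of characteristic two. Then \[ |V_*(FG)|=2\cdot |F|^{\frac{1}{2}(|G|+|G_T|)-1}. \]
   Context: For a finite $2$-group $G$ and a finite field $F$ of characteristic two, $FG$ is the group algebra, and $*$ is the classical involution of $FG$, i.e. the $F$-linear extension of $g\mapsto g^{-1}$ ($g\in G$). $V(FG)$ is the group of normalized units of $FG$ (units whose coefficients sum to $1$). $V_*(FG)=\{u\in V(FG) : u^*=u^{-1}\}$. $G_T=\{g\in G : g^2=1\}$ (so $1\in G_T$). $(x,y)=x^{-1}y^{-1}xy$ denotes the commutator. *)

theory Defs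
  imports Complex_Main "HOL-Library.Cardinality" "HOL-Algebra.Coset" "HOL-Algebra.Ring"
begin

text \<open>
  A word over the generators: the letter \<open>(x, True)\<close> stands for the generator \<open>x\<close> and
  \<open>(x, False)\<close> for its formal inverse.
\<close>

type_synonym 'a word = "('a \<times> bool) list"

definition word_inv :: "'a word \<Rightarrow> 'a word" where
  "word_inv w = rev (map (\<lambda>(x, e). (x, \<not> e)) w)"

definition word_comm :: "'a word \<Rightarrow> 'a word \<Rightarrow> 'a word" where
  "word_comm u v = word_inv u @ word_inv v @ u @ v"

text \<open>
  A pair \<open>(l, r)\<close> in \<open>R\<close> is the defining relation \<open>l = r\<close>. The predicate below is the least
  congruence on words containing \<open>R\<close> and the free cancellations, so its classes are the elements
  of the free group modulo the normal closure of all \<open>l r\<^sup>-\<^sup>1\<close>.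
\<close>

inductive word_eq :: "('a word \<times> 'a word) set \<Rightarrow> 'a word \<Rightarrow> 'a word \<Rightarrow> bool"
  for R :: "('a word \<times> 'a word) set" where
  refl: "word_eq R u u"
| sym: "word_eq R u v \<Longrightarrow> word_eq R v u"
| trans: "word_eq R u v \<Longrightarrow> word_eq R v w \<Longrightarrow> word_eq R u w"
| append: "word_eq R u u' \<Longrightarrow> word_eq R v v' \<Longrightarrow> word_eq R (u @ v) (u' @ v')"
| cancel: "word_eq R [(x, e), (x, \<not> e)] []"
| relation: "(l, r) \<in> R \<Longrightarrow> word_eq R l r"

text \<open>All elements of the generator type \<open>'a\<close> serve as generators.\<close>

definition presented_group :: "('a word \<times> 'a word) set \<Rightarrow> 'a word set monoid" where
  "presented_group R =
    \<lparr>carrier = UNIV // {(u, v). word_eq R u v},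
     monoid.mult = (\<lambda>A B. {w. \<exists>u\<in>A. \<exists>v\<in>B. word_eq R (u @ v) w}),
     one = {w. word_eq R [] w}\<rparr>"

datatype H_gen = GenA | GenB | GenC

definition H_relations :: "nat \<Rightarrow> (H_gen word \<times> H_gen word) set" where
  "H_relations n =
    (let a = [(GenA, True)]; b = [(GenB, True)]; c = [(GenC, True)] in
      {(concat (replicate (2 ^ (n - 2)) a), []),
       (b @ b, []),
       (c @ c, []),
       (word_comm a b, c),
       (word_comm a c, []),
       (word_comm b c, [])})"

text \<open>The group \<open>H\<close> of order \<open>2 ^ n\<close> (the parameter is the exponent \<open>n\<close>, not the order).\<close>

definition H_group :: "nat \<Rightarrow> H_gen word set monoid" where
  "H_group n = presented_group (H_relations n)"

text \<open>
  The group algebra \<open>F G\<close> of a finite group \<open>G\<close> (finiteness matters for the sum in the product),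
  with \<open>F\<close> given as a field type: an element is its coefficient function, which is zero outside
  the carrier.
\<close>

definition group_algebra :: "('g, 'm) monoid_scheme \<Rightarrow> ('g \<Rightarrow> 'f::field) ring" where
  "group_algebra G =
    \<lparr>carrier = {x. \<forall>g. g \<notin> carrier G \<longrightarrow> x g = 0},
     monoid.mult = (\<lambda>x y g. if g \<in> carrier G
                     then \<Sum>h\<in>carrier G. x h * y (inv\<^bsub>G\<^esub> h \<otimes>\<^bsub>G\<^esub> g) else 0),
     one = (\<lambda>g. if g = \<one>\<^bsub>G\<^esub> then 1 else 0),
     zero = (\<lambda>g. 0),
     ring.add = (\<lambda>x y g. x g + y g)\<rparr>"

text \<open>The linear extension of \<open>h \<mapsto> h\<^sup>-\<^sup>1\<close>: the coefficient at \<open>g\<close> collects all \<open>h\<close> with inverse \<open>g\<close>.\<close>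

definition classical_involution ::
    "('g, 'm) monoid_scheme \<Rightarrow> ('g \<Rightarrow> 'f::field) \<Rightarrow> 'g \<Rightarrow> 'f" where
  "classical_involution G x g = (\<Sum>h\<in>{h \<in> carrier G. inv\<^bsub>G\<^esub> h = g}. x h)"

definition normalized_units :: "('g, 'm) monoid_scheme \<Rightarrow> ('g \<Rightarrow> 'f::field) set" where
  "normalized_units G = {u \<in> Units (group_algebra G). (\<Sum>g\<in>carrier G. u g) = 1}"

definition unitary_units :: "('g, 'm) monoid_scheme \<Rightarrow> ('g \<Rightarrow> 'f::field) set" where
  "unitary_units G =
    {u \<in> normalized_units G. classical_involution G u = inv\<^bsub>group_algebra G\<^esub> u}"

definition square_one_elements :: "('g, 'm) monoid_scheme \<Rightarrow> 'g set" where
  "square_one_elements G = {g \<in> carrier G. g [^]\<^bsub>G\<^esub> (2::nat) = \<one>\<^bsub>G\<^esub>}"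

end

theory Submission
  imports Defs "HOL-Library.Function_Algebras" "HOL-Algebra.Elementary_Groups"
begin

text \<open>
  A unit \<open>x\<close> is unitary iff \<open>x x\<^sup>* = 1\<close>. Let \<open>G \<rightarrow> K\<close> be a surjection with kernel \<open>{1, c}\<close> of
  order two. The elements of \<open>F G\<close> killed by \<open>F G \<rightarrow> F K\<close> are the \<open>(1 + c) z\<close> with \<open>z \<in> F K\<close>, so over
  a unitary \<open>v\<close> that lifts to a unitary \<open>u\<close> all unitary lifts are \<open>(1 + (1 + c) y) u\<close> with \<open>y = y\<^sup>*\<close>;
  there are \<open>q\<close> to the power \<open>(|K| + |K\<^sub>T|) / 2\<close> of them, where \<open>q = |F|\<close>. For an arbitrary lift
  \<open>u u\<^sup>* = 1 + (1 + c) w\<close> with \<open>w = w\<^sup>*\<close>, and \<open>u\<close> can be corrected to a unitary element as soon as \<open>w\<close>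
  vanishes on \<open>K\<^sub>T\<close>, since then \<open>w = y + y\<^sup>*\<close>. In characteristic two the coefficients of \<open>u u\<^sup>*\<close> at
  involutions of \<open>G\<close> vanish, so there is no obstruction when \<open>K\<^sub>T\<close> lifts to \<open>G\<^sub>T\<close>, and the formula passes
  from \<open>K\<close> to \<open>G\<close>. This applies to \<open>H \<rightarrow> C \<times> C\<^sub>2 \<rightarrow> C\<close> with \<open>C\<close> cyclic of order \<open>2\<^sup>n\<^sup>-\<^sup>2\<close>. For \<open>C\<close> itself one
  inducts along \<open>C\<^bsub>8r\<^esub> \<rightarrow> C\<^bsub>4r\<^esub>\<close>, where the obstruction is a homomorphism onto \<open>(F, +)\<close>.
\<close>

section \<open>Involutions and characteristic two\<close>

text \<open>An injection of \<open>S\<close> into the naturals orders each two-element orbit, and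
  \<open>R\<close> collects the smaller points. The fixed points together with \<open>R\<close> then
  represent all orbits, and the last equation counts these as half of |S| plus the number of fixed
  points, which is where the exponent of the final formula comes from.\<close>

lemma involution_orbit_reps:
  fixes s :: "'a \<Rightarrow> 'a"
  assumes fin: "finite S" and cl: "\<And>x. x \<in> S \<Longrightarrow> s x \<in> S" and inv: "\<And>x. x \<in> S \<Longrightarrow> s (s x) = x"
  obtains R where "R \<subseteq> S" "R \<inter> s ` R = {}" "{x \<in> S. s x = x} \<inter> (R \<union> s ` R) = {}"
    "S = {x \<in> S. s x = x} \<union> (R \<union> s ` R)" "inj_on s R"
    "card S + card {x \<in> S. s x = x} = 2 * card ({x \<in> S. s x = x} \<union> R)"
proof -
  obtain f :: "'a \<Rightarrow> nat" where f: "inj_on f S"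
    using finite_imp_inj_to_nat_seg[OF fin] by blast
  define R where "R = {x \<in> S. f x < f (s x)}"
  have sub: "R \<subseteq> S" by (auto simp: R_def)
  have disj: "R \<inter> s ` R = {}" "{x \<in> S. s x = x} \<inter> (R \<union> s ` R) = {}"
    by (auto simp: R_def inv)
  have inj: "inj_on s R" by (rule inj_on_inverseI[of _ s]) (auto simp: R_def inv)
  have "x \<in> s ` R" if "x \<in> S" "s x \<noteq> x" "x \<notin> R" for x
  proof
    show "x = s (s x)" using inv that by simp
    have "f x \<noteq> f (s x)" using that cl inj_onD[OF f] by metis
    then show "s x \<in> R" using that cl inv by (auto simp: R_def)
  qed
  then have S: "S = {x \<in> S. s x = x} \<union> (R \<union> s ` R)" using cl by (auto simp: R_def)
  have finR: "finite R" using sub fin by (rule finite_subset)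
  have "card S = card ({x \<in> S. s x = x} \<union> (R \<union> s ` R))" using S by simp
  also have "\<dots> = card {x \<in> S. s x = x} + (card R + card R)"
    using disj inj finR fin by (simp add: card_Un_disjoint card_image)
  finally have "card S + card {x \<in> S. s x = x} = 2 * (card {x \<in> S. s x = x} + card R)" by simp
  also have "card {x \<in> S. s x = x} + card R = card ({x \<in> S. s x = x} \<union> R)"
    using disj(2) finR fin by (subst card_Un_disjoint) auto
  finally show thesis using that[OF sub disj S inj] by simp
qed

lemma char_two_add_self:
  assumes "CHAR('f::semiring_1) = 2"
  shows "(x::'f) + x = 0"
proof -
  have "(of_nat 2 :: 'f) = 0" using assms of_nat_CHAR[where 'a='f] by simp
  then show ?thesis by (metis mult_2 mult_zero_left of_nat_numeral)
qed

lemma char_two_add_eq_0_iff: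
  assumes "CHAR('f::ring_1) = 2"
  shows "(x::'f) + y = 0 \<longleftrightarrow> x = y"
  using char_two_add_self[OF assms] by (metis add_left_cancel)

lemma char_two_sum_square:
  fixes f :: "'a \<Rightarrow> 'f::comm_ring_1"
  assumes char: "CHAR('f) = 2"
  shows "(\<Sum>x\<in>S. f x ^ 2) = (\<Sum>x\<in>S. f x) ^ 2"
proof (induction S rule: infinite_finite_induct)
  case (insert x S)
  have "(a + b)^2 = a^2 + b^2" for a b :: 'f
  proof -
    have "(a + b)^2 = a^2 + b^2 + (a * b + a * b)" by (simp only: power2_eq_square distrib_left distrib_right ac_simps)
    then show ?thesis by (simp only: char_two_add_self[OF char] add_0_right)
  qed
  then show ?case unfolding sum.insert[OF insert.hyps] insert.IH by simp
qed auto

text \<open>Without fixed points the terms pair off along the orbits of \<open>s\<close>, and two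
  equal terms cancel.\<close>

lemma char_two_sum_involution:
  fixes f :: "'a \<Rightarrow> 'f::comm_ring_1"
  assumes char: "CHAR('f) = 2" and fin: "finite S"
    and s: "\<And>x. x \<in> S \<Longrightarrow> s x \<in> S" "\<And>x. x \<in> S \<Longrightarrow> s (s x) = x" "\<And>x. x \<in> S \<Longrightarrow> s x \<noteq> x"
    and f: "\<And>x. x \<in> S \<Longrightarrow> f (s x) = f x"
  shows "sum f S = 0"
proof -
  obtain R where R: "R \<subseteq> S" "R \<inter> s ` R = {}" "S = {x \<in> S. s x = x} \<union> (R \<union> s ` R)" "inj_on s R"
    by (rule involution_orbit_reps[of S s]) (use fin s(1,2) in blast)+
  have "{x \<in> S. s x = x} = {}" using s(3) by blast
  then have "S = R \<union> s ` R" using R(3) by blast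
  moreover have "finite R" using R(1) fin finite_subset by blast
  ultimately have "sum f S = sum f R + sum f (s ` R)"
    using R(2) by (simp add: sum.union_disjoint)
  also have "sum f (s ` R) = sum f R"
    using R(1,4) f by (simp add: sum.reindex subset_iff)
  finally show ?thesis using char_two_add_self[OF char] by simp
qed

text \<open>Squaring is injective because x = -y already means x = y; on a finite field it is
  therefore onto.\<close>

lemma char_two_square_surj:
  assumes "CHAR('f::{field,finite}) = 2"
  shows "\<exists>b::'f. b * b = a"
proof -
  have "inj (\<lambda>b::'f. b * b)"
  proof (rule injI)
    fix x y :: 'f assume "x * x = y * y"
    then have "x = y \<or> x = - y" by (simp add: square_eq_iff)
    moreover have "- y = y" using char_two_add_self[OF assms, of y] by (simp add: add_eq_0_iff)
    ultimately show "x = y" by auto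
  qed
  then have "surj (\<lambda>b::'f. b * b)" by (rule finite_UNIV_inj_surj[OF finite])
  then show ?thesis by (metis surjD)
qed

lemma card_supported_functions:
  assumes "finite S"
  shows "card {x :: 'a \<Rightarrow> 'f::{zero,finite}. \<forall>g. g \<notin> S \<longrightarrow> x g = 0} = CARD('f) ^ card S"
proof -
  have "bij_betw (\<lambda>x g. if g \<in> S then x g else 0) (S \<rightarrow>\<^sub>E (UNIV :: 'f set))
      {x. \<forall>g. g \<notin> S \<longrightarrow> x g = 0}"
    by (rule bij_betw_byWitness[where f' = "\<lambda>x. restrict x S"])
      (auto simp: fun_eq_iff PiE_def extensional_def)
  then show ?thesis
    using card_funcsetE[OF assms, of "UNIV :: 'f set"] bij_betw_same_card by fastforce
qed

section \<open>The group algebra of a finite group\<close>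

text \<open>\<open>ga\<close>, \<open>conv\<close> and \<open>star\<close> detach carrier, product
  and involution from the record \<open>group_algebra\<close>, so that computations take place in
  plain functions. \<open>star\<close> reads off the single coefficient that
  \<open>classical_involution\<close> collects in a sum; the link to the original notions is made in
  \<open>unitary_units_eq\<close>.\<close>

definition ga :: "('g, 'm) monoid_scheme \<Rightarrow> ('g \<Rightarrow> 'f::field) set" where
  "ga G = {x. \<forall>g. g \<notin> carrier G \<longrightarrow> x g = 0}"

definition conv :: "('g, 'm) monoid_scheme \<Rightarrow> ('g \<Rightarrow> 'f::field) \<Rightarrow> ('g \<Rightarrow> 'f) \<Rightarrow> 'g \<Rightarrow> 'f"
    (infixl "\<star>\<index>" 70) where
  "conv G x y = (\<lambda>g. if g \<in> carrier G
     then \<Sum>h\<in>carrier G. x h * y (inv\<^bsub>G\<^esub> h \<otimes>\<^bsub>G\<^esub> g) else 0)"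

definition star :: "('g, 'm) monoid_scheme \<Rightarrow> ('g \<Rightarrow> 'f::field) \<Rightarrow> 'g \<Rightarrow> 'f" where
  "star G x = (\<lambda>g. if g \<in> carrier G then x (inv\<^bsub>G\<^esub> g) else 0)"

text \<open>The element a g of the group algebra; \<open>sgl \<one> 1\<close> is its
  identity.\<close>

definition sgl :: "'g \<Rightarrow> 'f::zero \<Rightarrow> 'g \<Rightarrow> 'f" where
  "sgl g a = (\<lambda>h. if h = g then a else 0)"

locale finite_group = group +
  assumes finite_carrier [simp]: "finite (carrier G)"
begin

section \<open>The group algebra as an associative algebra with involution\<close>

lemma conv_in_ga [simp]: "x \<star> y \<in> ga G"
  by (simp add: ga_def conv_def)

lemma star_in_ga [simp]: "star G x \<in> ga G"
  by (simp add: ga_def star_def)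

lemma add_in_ga [simp]: "x \<in> ga G \<Longrightarrow> y \<in> ga G \<Longrightarrow> x + y \<in> ga G"
  by (simp add: ga_def)

lemma sgl_in_ga [simp]: "g \<in> carrier G \<Longrightarrow> sgl g a \<in> ga G"
  by (auto simp add: ga_def sgl_def)

lemma ga_eqI: "x \<in> ga G \<Longrightarrow> y \<in> ga G \<Longrightarrow> (\<And>g. g \<in> carrier G \<Longrightarrow> x g = y g) \<Longrightarrow> x = y"
  by (rule ext) (metis (mono_tags, lifting) ga_def mem_Collect_eq)

lemma finite_ga [simp]: "finite (ga G :: ('a \<Rightarrow> 'f::{field,finite}) set)"
proof -
  have "card (ga G :: ('a \<Rightarrow> 'f) set) > 0"
    unfolding ga_def by (simp add: card_supported_functions)
  then show ?thesis by (rule card_ge_0_finite)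
qed

lemma sum_translate: "k \<in> carrier G \<Longrightarrow> (\<Sum>h\<in>carrier G. f (k \<otimes> h)) = (\<Sum>h\<in>carrier G. f h)"
  by (rule sum.reindex_bij_witness[where i = "\<lambda>h. inv k \<otimes> h" and j = "\<lambda>h. k \<otimes> h"])
    (auto simp: m_assoc[symmetric])

lemma conv_assoc: "(x \<star> y) \<star> z = x \<star> (y \<star> z)"
proof (rule ga_eqI)
  fix g assume g: "g \<in> carrier G"
  have "((x \<star> y) \<star> z) g = (\<Sum>h\<in>carrier G. \<Sum>k\<in>carrier G. x k * y (inv k \<otimes> h) * z (inv h \<otimes> g))"
    using g by (simp add: conv_def sum_distrib_right)
  also have "\<dots> = (\<Sum>k\<in>carrier G. \<Sum>h\<in>carrier G. x k * y (inv k \<otimes> h) * z (inv h \<otimes> g))"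
    by (rule sum.swap)
  also have "\<dots> = (\<Sum>k\<in>carrier G. \<Sum>h\<in>carrier G. x k * (y h * z (inv h \<otimes> (inv k \<otimes> g))))"
  proof (rule sum.cong[OF HOL.refl])
    fix k assume k: "k \<in> carrier G"
    show "(\<Sum>h\<in>carrier G. x k * y (inv k \<otimes> h) * z (inv h \<otimes> g))
      = (\<Sum>h\<in>carrier G. x k * (y h * z (inv h \<otimes> (inv k \<otimes> g))))"
      unfolding sum_translate[OF k, symmetric, of "\<lambda>h. x k * y (inv k \<otimes> h) * z (inv h \<otimes> g)"]
      using k g by (intro sum.cong) (simp_all add: inv_mult_group m_assoc, simp add: m_assoc[symmetric])
  qed
  also have "\<dots> = (x \<star> (y \<star> z)) g"
    using g by (simp add: conv_def sum_distrib_left)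
  finally show "((x \<star> y) \<star> z) g = (x \<star> (y \<star> z)) g" .
qed simp_all

lemma conv_add_left: "(x + y) \<star> z = x \<star> z + y \<star> z"
  and conv_add_right: "x \<star> (y + z) = x \<star> y + x \<star> z"
  by (auto simp: conv_def fun_eq_iff sum.distrib algebra_simps)

lemma star_add: "star G (x + y) = star G x + star G y"
  by (auto simp: star_def)

lemma star_star: "x \<in> ga G \<Longrightarrow> star G (star G x) = x"
  by (rule ga_eqI) (simp_all, simp add: star_def)

lemma star_conv: "star G (x \<star> y) = star G y \<star> star G x"
proof (rule ga_eqI)
  fix g assume g: "g \<in> carrier G"
  have "(star G y \<star> star G x) g = (\<Sum>h\<in>carrier G. y (inv h) * x (inv g \<otimes> h))"
    using g by (auto simp: conv_def star_def inv_mult_group intro!: sum.cong)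
  also have "\<dots> = (\<Sum>h\<in>carrier G. y (inv (g \<otimes> h)) * x (inv g \<otimes> (g \<otimes> h)))"
    by (rule sum_translate[symmetric, OF g])
  also have "\<dots> = (\<Sum>h\<in>carrier G. x h * y (inv h \<otimes> inv g))"
    using g by (intro sum.cong) (simp_all add: inv_mult_group m_assoc[symmetric])
  also have "\<dots> = star G (x \<star> y) g" using g by (simp add: conv_def star_def)
  finally show "star G (x \<star> y) g = (star G y \<star> star G x) g" by simp
qed simp_all

lemma sgl_conv:
  assumes "k \<in> carrier G"
  shows "sgl k a \<star> y = (\<lambda>g. if g \<in> carrier G then a * y (inv k \<otimes> g) else 0)"
proof -
  have "(\<Sum>h\<in>carrier G. sgl k a h * y (inv h \<otimes> g)) = a * y (inv k \<otimes> g)" for g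
  proof -
    have "(\<Sum>h\<in>carrier G. sgl k a h * y (inv h \<otimes> g))
        = (\<Sum>h\<in>carrier G. if h = k then a * y (inv k \<otimes> g) else 0)"
      by (intro sum.cong) (auto simp: sgl_def)
    then show ?thesis using assms by simp
  qed
  then show ?thesis by (simp add: conv_def fun_eq_iff)
qed

lemma sgl_conv_sgl:
  assumes "g \<in> carrier G" "h \<in> carrier G"
  shows "sgl g a \<star> sgl h b = sgl (g \<otimes> h) (a * b)"
proof (rule ga_eqI)
  fix k assume "k \<in> carrier G"
  then show "(sgl g a \<star> sgl h b) k = sgl (g \<otimes> h) (a * b) k"
    using assms unfolding sgl_conv[OF assms(1)] by (auto simp: sgl_def inv_solve_left')
qed (use assms in simp_all)

lemma star_sgl: "g \<in> carrier G \<Longrightarrow> star G (sgl g a) = sgl (inv g) a"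
  by (rule ga_eqI) (simp_all, auto simp: star_def sgl_def)

lemma star_one: "star G (sgl \<one> 1) = sgl \<one> 1"
  by (simp add: star_sgl)

lemma one_conv: "x \<in> ga G \<Longrightarrow> sgl \<one> 1 \<star> x = x"
  by (auto simp: sgl_conv ga_def fun_eq_iff)

lemma conv_one: "x \<in> ga G \<Longrightarrow> x \<star> sgl \<one> 1 = x"
  by (metis star_star star_conv star_one one_conv conv_in_ga star_in_ga sgl_in_ga one_closed)

text \<open>In a finite algebra a one-sided inverse is two-sided: x y = 1 makes left multiplication
  by y injective, hence onto, so y has a right inverse z, and x = x (y z) = z.\<close>

lemma conv_eq_one_commute:
  fixes x y :: "'a \<Rightarrow> 'f::{field,finite}"
  assumes x: "x \<in> ga G" and y: "y \<in> ga G" and xy: "x \<star> y = sgl \<one> 1"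
  shows "y \<star> x = sgl \<one> 1"
proof -
  have "inj_on ((\<star>) y) (ga G)"
    by (rule inj_on_inverseI[of _ "(\<star>) x"]) (simp add: conv_assoc[symmetric] xy one_conv)
  then have "(\<star>) y ` ga G = ga G"
    by (intro endo_inj_surj) auto
  moreover have "sgl \<one> 1 \<in> (ga G :: ('a \<Rightarrow> 'f) set)" by simp
  ultimately obtain z where z: "z \<in> ga G" "y \<star> z = sgl \<one> 1"
    by (metis imageE)
  have "x = x \<star> (y \<star> z)" using z x by (simp add: conv_one)
  also have "\<dots> = z" using z(1) by (simp add: conv_assoc[symmetric] xy one_conv)
  finally show ?thesis using z by simp
qed

lemma conv_commute:
  assumes comm: "\<And>g h. g \<in> carrier G \<Longrightarrow> h \<in> carrier G \<Longrightarrow> g \<otimes> h = h \<otimes> g"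
  shows "x \<star> y = y \<star> x"
proof (rule ga_eqI)
  fix g assume g: "g \<in> carrier G"
  have 1: "inv (inv h \<otimes> g) \<otimes> g = h" if "h \<in> carrier G" for h
  proof -
    have "inv (inv h \<otimes> g) \<otimes> g = inv g \<otimes> (h \<otimes> g)" using g that by (simp add: inv_mult_group m_assoc)
    also have "\<dots> = inv g \<otimes> (g \<otimes> h)" using comm[OF g that] by simp
    also have "\<dots> = h" using g that by (simp add: m_assoc[symmetric])
    finally show ?thesis .
  qed
  have "(\<Sum>h\<in>carrier G. x h * y (inv h \<otimes> g)) = (\<Sum>h\<in>carrier G. y h * x (inv h \<otimes> g))"
    by (rule sum.reindex_bij_witness[where i = "\<lambda>h. inv h \<otimes> g" and j = "\<lambda>h. inv h \<otimes> g"])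
      (use g 1 in \<open>simp_all add: mult.commute\<close>)
  then show "(x \<star> y) g = (y \<star> x) g" using g by (simp add: conv_def)
qed simp_all

section \<open>Coefficients of x times its adjoint, and the unitary condition\<close>

lemma conv_star_apply:
  assumes "g \<in> carrier G"
  shows "(x \<star> star G x) g = (\<Sum>h\<in>carrier G. x h * x (inv g \<otimes> h))"
  using assms by (auto simp: conv_def star_def inv_mult_group intro!: sum.cong)

text \<open>The coefficient is the sum of all squares of coefficients, which by Frobenius is the
  square of the augmentation.\<close>

lemma conv_star_apply_one:
  fixes x :: "'a \<Rightarrow> 'f::field"
  assumes "CHAR('f) = 2"
  shows "(x \<star> star G x) \<one> = (\<Sum>g\<in>carrier G. x g) ^ 2"
  using char_two_sum_square[OF assms, of x "carrier G"]
  by (simp add: conv_star_apply) (simp add: power2_eq_square)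

text \<open>Left translation by g is a fixed-point-free involution of the index set and swaps the
  two factors of each term x(h) x(g h), so the terms cancel in pairs.\<close>

lemma conv_star_apply_involution:
  fixes x :: "'a \<Rightarrow> 'f::field"
  assumes char: "CHAR('f) = 2" and g: "g \<in> carrier G" "g \<otimes> g = \<one>" "g \<noteq> \<one>"
  shows "(x \<star> star G x) g = 0"
proof -
  have inv: "inv g = g" using g by (simp add: inv_equality)
  have gg: "g \<otimes> (g \<otimes> h) = h" if "h \<in> carrier G" for h
    using g that by (simp add: m_assoc[symmetric])
  have "g \<otimes> h \<noteq> h" if "h \<in> carrier G" for h
    using g that by (metis l_one one_closed right_cancel)
  then show ?thesis
    unfolding conv_star_apply[OF g(1)] inv
    using g by (intro char_two_sum_involution[OF char, where s = "(\<otimes>) g"]) (simp_all add: gg)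
qed

text \<open>The single equation already contains the other requirements:
  \<open>conv_eq_one_commute\<close> makes x a unit, and comparing coefficients at the identity
  gives augmentation squared equal to 1, hence augmentation 1 because -1 = 1.\<close>

lemma unitary_units_eq:
  assumes char: "CHAR('f::{field,finite}) = 2"
  shows "unitary_units G = {x \<in> ga G. x \<star> star G x = (sgl \<one> 1 :: 'a \<Rightarrow> 'f)}"
proof -
  let ?A = "group_algebra G :: ('a \<Rightarrow> 'f) ring"
  have carrier: "carrier ?A = ga G" and mult: "monoid.mult ?A = (\<star>)" and one: "\<one>\<^bsub>?A\<^esub> = sgl \<one> 1"
    by (auto simp: group_algebra_def ga_def conv_def sgl_def fun_eq_iff)
  interpret A: monoid ?A
    by (rule monoidI) (simp_all add: carrier mult one conv_assoc one_conv conv_one)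
  have ci: "classical_involution G x = star G x" if "x \<in> ga G" for x :: "'a \<Rightarrow> 'f"
  proof
    fix g
    have "{h \<in> carrier G. inv h = g} = (if g \<in> carrier G then {inv g} else {})" by auto
    then show "classical_involution G x g = star G x g"
      by (simp add: classical_involution_def star_def)
  qed
  show ?thesis
  proof (intro equalityI subsetI)
    fix x :: "'a \<Rightarrow> 'f" assume "x \<in> unitary_units G"
    then have x: "x \<in> Units ?A" "classical_involution G x = inv\<^bsub>?A\<^esub> x"
      by (auto simp: unitary_units_def normalized_units_def)
    then have "x \<in> ga G" using carrier by blast
    then show "x \<in> {x \<in> ga G. x \<star> star G x = sgl \<one> 1}"
      using A.Units_r_inv[OF x(1)] x(2) ci by (simp add: mult one)
  next
    fix x :: "'a \<Rightarrow> 'f" assume "x \<in> {x \<in> ga G. x \<star> star G x = sgl \<one> 1}"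
    then have x: "x \<in> ga G" "x \<star> star G x = sgl \<one> 1" by auto
    then have x': "star G x \<star> x = sgl \<one> 1" by (simp add: conv_eq_one_commute)
    have u: "x \<in> Units ?A"
      using x x' by (auto simp: Units_def carrier mult one intro!: bexI[of _ "star G x"])
    have "(\<Sum>g\<in>carrier G. x g) ^ 2 = 1"
      using conv_star_apply_one[OF char, of x] x(2) by (simp add: sgl_def)
    then have "(\<Sum>g\<in>carrier G. x g) = 1"
      using char_two_add_self[OF char, of 1] by (metis add_eq_0_iff power2_eq_1_iff)
    moreover have "classical_involution G x = inv\<^bsub>?A\<^esub> x"
      using A.inv_unique'[of x "star G x"] x x' ci by (simp add: carrier mult one)
    ultimately show "x \<in> unitary_units G"
      using u by (simp add: unitary_units_def normalized_units_def)
  qed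
qed

text \<open>A self-adjoint element is constant on the orbits of inversion, so its values on the
  orbit representatives \<open>?T \<union> R\<close> can be chosen freely and determine it.\<close>

lemma card_self_adjoint:
  "card {y \<in> ga G. star G y = (y :: 'a \<Rightarrow> 'f::{field,finite})}
    = CARD('f) ^ ((card (carrier G) + card {g \<in> carrier G. inv g = g}) div 2)"
  (is "card ?Y = _ ^ ?e")
proof -
  let ?S = "carrier G" and ?T = "{g \<in> carrier G. inv g = g}"
  obtain R where R: "R \<subseteq> ?S" "R \<inter> m_inv G ` R = {}" "?T \<inter> (R \<union> m_inv G ` R) = {}"
    "?S = ?T \<union> (R \<union> m_inv G ` R)" "card ?S + card ?T = 2 * card (?T \<union> R)"
    by (rule involution_orbit_reps[of ?S "m_inv G"]) auto
  have fin: "finite R" using R(1) by (rule finite_subset) simp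
  have "(card ?S + card ?T) div 2 = card (?T \<union> R)"
    using R(5) by simp
  moreover have "bij_betw (\<lambda>y g. if g \<in> ?T \<union> R then y g else 0) ?Y {x. \<forall>g. g \<notin> ?T \<union> R \<longrightarrow> x g = 0}"
  proof (rule bij_betw_byWitness[where f' = "\<lambda>x g. if g \<in> ?T \<union> R then x g else
      if g \<in> ?S then x (inv g) else 0"])
    show "\<forall>y\<in>?Y. (\<lambda>g. if g \<in> ?T \<union> R then if g \<in> ?T \<union> R then y g else 0 else
      if g \<in> ?S then if inv g \<in> ?T \<union> R then y (inv g) else 0 else 0) = y"
    proof (intro ballI ext)
      fix y g assume "y \<in> ?Y"
      then have y: "y \<in> ga G" "\<And>h. (if h \<in> carrier G then y (inv h) else 0) = y h"
        by (auto simp: star_def fun_eq_iff)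
      have "inv g \<in> R" if "g \<in> ?S" "g \<notin> ?T" "g \<notin> R"
        using that R(1,4) by force
      then show "(if g \<in> ?T \<union> R then if g \<in> ?T \<union> R then y g else 0 else
        if g \<in> ?S then if inv g \<in> ?T \<union> R then y (inv g) else 0 else 0) = y g"
        using y(2)[of g] R(1) by (auto split: if_splits)
    qed
    show "\<forall>x\<in>{x. \<forall>g. g \<notin> ?T \<union> R \<longrightarrow> x g = 0}. (\<lambda>g. if g \<in> ?T \<union> R then if g \<in> ?T \<union> R then x g else
      if g \<in> ?S then x (inv g) else 0 else 0) = x"
      by auto
    show "(\<lambda>y g. if g \<in> ?T \<union> R then y g else 0) ` ?Y \<subseteq> {x. \<forall>g. g \<notin> ?T \<union> R \<longrightarrow> x g = 0}"
      by auto
    show "(\<lambda>x g. if g \<in> ?T \<union> R then x g else if g \<in> ?S then x (inv g) else 0) `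
      {x. \<forall>g. g \<notin> ?T \<union> R \<longrightarrow> x g = 0} \<subseteq> ?Y"
    proof (intro image_subsetI CollectI conjI)
      fix x :: "'a \<Rightarrow> 'f" assume "x \<in> {x. \<forall>g. g \<notin> ?T \<union> R \<longrightarrow> x g = 0}"
      then have x: "x g = 0" if "g \<notin> ?T \<union> R" for g using that by auto
      let ?y = "\<lambda>g. if g \<in> ?T \<union> R then x g else if g \<in> ?S then x (inv g) else 0"
      show "?y \<in> ga G" using R(1) by (auto simp: ga_def)
      show "star G ?y = ?y"
      proof (rule ext)
        fix g
        have 1: "g \<notin> ?T \<Longrightarrow> g \<notin> R \<Longrightarrow> g \<in> ?S \<Longrightarrow> inv g \<in> R"
          using R(1,4) by force
        have 2: "g \<in> R \<Longrightarrow> g \<in> ?S \<and> g \<notin> ?T \<and> inv g \<notin> R"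
          using R(1-3) by blast
        show "star G ?y g = ?y g"
        proof (cases "g \<in> R")
          case True
          with 2 show ?thesis by (auto simp: star_def)
        next
          case False
          with 1 show ?thesis by (auto simp: star_def)
        qed
      qed
    qed
  qed
  ultimately show ?thesis
    using card_supported_functions[of "?T \<union> R", where 'f='f] fin bij_betw_same_card by fastforce
qed

text \<open>Cutting \<open>w\<close> down to one point of each two-element orbit of inversion gives
  \<open>y\<close>; its adjoint supplies the other points. At self-inverse elements both summands
  are zero, which matches the hypothesis on \<open>w\<close>.\<close>

lemma self_adjoint_decompose:
  fixes w :: "'a \<Rightarrow> 'f::field"
  assumes w: "w \<in> ga G" "star G w = w" and w0: "\<And>g. g \<in> carrier G \<Longrightarrow> inv g = g \<Longrightarrow> w g = 0"
  obtains y where "y \<in> ga G" "w = y + star G y"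
proof -
  let ?S = "carrier G" and ?T = "{g \<in> carrier G. inv g = g}"
  obtain R where R: "R \<subseteq> ?S" "R \<inter> m_inv G ` R = {}" "?T \<inter> (R \<union> m_inv G ` R) = {}"
    "?S = ?T \<union> (R \<union> m_inv G ` R)"
    by (rule involution_orbit_reps[of ?S "m_inv G"]) auto
  define y where "y = (\<lambda>g. if g \<in> R then w g else 0)"
  have y: "y \<in> ga G" using R(1) by (auto simp: ga_def y_def)
  have inv: "w (inv g) = w g" if "g \<in> ?S" for g
    using fun_cong[OF w(2), of g] that by (simp add: star_def)
  have "w = y + star G y"
  proof (rule ga_eqI)
    fix g assume g: "g \<in> ?S"
    have 1: "g \<notin> ?T \<Longrightarrow> g \<notin> R \<Longrightarrow> inv g \<in> R"
      using R(1,4) g by force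
    have 2: "g \<in> R \<Longrightarrow> inv g \<notin> R" "g \<in> ?T \<Longrightarrow> g \<notin> R"
      using R(2,3) by auto
    consider "g \<in> ?T" "g \<notin> R" "inv g \<notin> R" | "g \<in> R" "inv g \<notin> R" | "inv g \<in> R" "g \<notin> R"
    proof (cases "g \<in> ?T")
      case True
      then have "inv g = g" by simp
      with True 2 that(1) show thesis by simp
    next
      case False
      with 1 2 that(2,3) show thesis by blast
    qed
    then show "w g = (y + star G y) g"
      using g w0[of g] inv[of g] by cases (simp_all add: y_def star_def)
  qed (use w y in simp_all)
  with y show thesis by (rule that)
qed

end

text \<open>The claimed count multiplied by |F|, which removes the -1 from the exponent and keeps
  everything in the naturals. The division by 2 is exact by
  \<open>even_order_add_card_square_one\<close>. The second argument only fixes the coefficient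
  field.\<close>

definition unitary_formula :: "('g, 'm) monoid_scheme \<Rightarrow> 'f::{field,finite} itself \<Rightarrow> bool" where
  "unitary_formula G F \<longleftrightarrow> card (unitary_units G :: ('g \<Rightarrow> 'f) set) * CARD('f)
     = 2 * CARD('f) ^ ((order G + card (square_one_elements G)) div 2)"

context finite_group
begin

lemma square_one_elements_eq: "square_one_elements G = {g \<in> carrier G. inv g = g}"
  by (auto simp: square_one_elements_def numeral_2_eq_2 inv_equality) (metis r_inv)

lemma even_order_add_card_square_one: "even (order G + card (square_one_elements G))"
proof -
  have "\<exists>k. card (carrier G) + card {g \<in> carrier G. inv g = g} = 2 * k"
    by (rule involution_orbit_reps[of "carrier G" "m_inv G"]) auto
  then obtain k where "card (carrier G) + card {g \<in> carrier G. inv g = g} = 2 * k" by blast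
  then show ?thesis unfolding order_def square_one_elements_eq by simp
qed

end

section \<open>Lifting unitary units along a quotient by a subgroup of order two\<close>

text \<open>\<open>c\<close> generates the kernel of order two of the surjection \<open>p\<close>.
  The coefficient field enters through the type argument \<open>F\<close>, since the groups and the
  map do not mention it.\<close>

locale double_cover = G: finite_group G + K: finite_group K
  for G :: "('g, 'm) monoid_scheme" (structure) and K :: "('k, 'n) monoid_scheme" (structure) +
  fixes p :: "'g \<Rightarrow> 'k" and c :: 'g and F :: "'f::{field,finite} itself"
  assumes hom: "p \<in> hom G K"
    and surj: "p ` carrier G = carrier K"
    and ker: "{g \<in> carrier G. p g = \<one>\<^bsub>K\<^esub>} = {\<one>, c}"
    and c_neq_one: "c \<noteq> \<one>"
    and char: "CHAR('f) = 2"
begin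

section \<open>The algebra homomorphism F G to F K and its kernel\<close>

definition push :: "('g \<Rightarrow> 'f) \<Rightarrow> 'k \<Rightarrow> 'f" where
  "push x = (\<lambda>k. if k \<in> carrier K then \<Sum>g\<in>{g \<in> carrier G. p g = k}. x g else 0)"

text \<open>This is (1 + c) z for any z in F G with \<open>push z = w\<close>: each coefficient of
  \<open>w\<close> is repeated on both points of its fiber. It identifies F K with the kernel of
  \<open>push\<close>.\<close>

definition pull :: "('k \<Rightarrow> 'f) \<Rightarrow> 'g \<Rightarrow> 'f" where
  "pull w = (\<lambda>g. if g \<in> carrier G then w (p g) else 0)"

lemma p_closed [simp]: "g \<in> carrier G \<Longrightarrow> p g \<in> carrier K"
  using surj by blast

lemma p_surjE:
  assumes "k \<in> carrier K"
  obtains g where "g \<in> carrier G" "k = p g"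
  using assms surj by blast

lemma p_mult [simp]: "g \<in> carrier G \<Longrightarrow> h \<in> carrier G \<Longrightarrow> p (g \<otimes> h) = p g \<otimes>\<^bsub>K\<^esub> p h"
  using hom by (simp add: hom_mult)

lemma p_one [simp]: "p \<one> = \<one>\<^bsub>K\<^esub>"
  using ker by blast

lemma p_inv [simp]: "g \<in> carrier G \<Longrightarrow> p (inv g) = inv\<^bsub>K\<^esub> p g"
  by (rule K.inv_equality[symmetric]) (simp_all flip: p_mult)

lemma c_closed [simp]: "c \<in> carrier G" and p_c [simp]: "p c = \<one>\<^bsub>K\<^esub>"
  using ker by blast+

lemma fiber_eq:
  assumes g: "g \<in> carrier G"
  shows "{h \<in> carrier G. p h = p g} = {g, g \<otimes> c}"
proof (intro equalityI subsetI)
  fix h assume "h \<in> {h \<in> carrier G. p h = p g}"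
  then have h: "h \<in> carrier G" "p h = p g" by auto
  then have "inv g \<otimes> h \<in> {g \<in> carrier G. p g = \<one>\<^bsub>K\<^esub>}" using g by simp
  then have "inv g \<otimes> h = \<one> \<or> inv g \<otimes> h = c" unfolding ker by simp
  then show "h \<in> {g, g \<otimes> c}" using g h by (auto simp: G.inv_solve_left')
qed (use g in auto)

lemma mult_c_neq: "g \<in> carrier G \<Longrightarrow> g \<noteq> g \<otimes> c"
  using c_neq_one G.l_cancel_one by (metis c_closed)

lemma p_eqD: "g \<in> carrier G \<Longrightarrow> h \<in> carrier G \<Longrightarrow> p h = p g \<Longrightarrow> h = g \<or> h = g \<otimes> c"
  using fiber_eq by blast

lemma card_preimage:
  assumes A: "A \<subseteq> carrier K"
  shows "card {g \<in> carrier G. p g \<in> A} = 2 * card A"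
proof -
  have fin: "finite A" using A finite_subset K.finite_carrier by blast
  have "{g \<in> carrier G. p g \<in> A} = (\<Union>k\<in>A. {g \<in> carrier G. p g = k})" by auto
  also have "card \<dots> = (\<Sum>k\<in>A. card {g \<in> carrier G. p g = k})"
    using fin by (intro card_UN_disjoint) auto
  also have "\<dots> = (\<Sum>k\<in>A. 2)"
  proof (rule sum.cong)
    fix k assume "k \<in> A"
    then obtain g where g: "g \<in> carrier G" "k = p g" using A surj by blast
    then show "card {g \<in> carrier G. p g = k} = 2"
      using fiber_eq[OF g(1)] mult_c_neq[OF g(1)] by simp
  qed simp
  finally show ?thesis by simp
qed

lemma push_in_ga [simp]: "push x \<in> ga K"
  by (simp add: ga_def push_def)

lemma pull_in_ga [simp]: "pull w \<in> ga G"
  by (simp add: ga_def pull_def)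

lemma push_add: "push (x + y) = push x + push y"
  by (auto simp: push_def fun_eq_iff sum.distrib)

lemma pull_add: "pull (x + y) = pull x + pull y"
  by (auto simp: pull_def fun_eq_iff)

lemma push_p: "g \<in> carrier G \<Longrightarrow> push x (p g) = x g + x (g \<otimes> c)"
  using mult_c_neq by (simp add: push_def fiber_eq)

lemma add_self: "x + x = (0 :: 'a \<Rightarrow> 'f)"
  by (rule ext) (simp only: plus_fun_apply zero_fun_apply char_two_add_self[OF char])

lemma add_self_left: "x + (x + y) = (y :: 'a \<Rightarrow> 'f)"
  by (simp only: add.assoc[symmetric] add_self add_0_left)

lemma push_pull: "push (pull w) = 0"
proof (rule K.ga_eqI)
  fix k assume "k \<in> carrier K"
  then obtain g where g: "g \<in> carrier G" "k = p g" using surj by blast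
  then show "push (pull w) k = 0 k"
    by (simp add: push_p) (simp add: pull_def char_two_add_self[OF char])
qed (simp_all add: ga_def push_def)

lemma pull_inj: "w \<in> ga K \<Longrightarrow> w' \<in> ga K \<Longrightarrow> pull w = pull w' \<Longrightarrow> w = w'"
proof (rule K.ga_eqI)
  fix k assume eq: "pull w = pull w'" and "k \<in> carrier K"
  then obtain g where g: "g \<in> carrier G" "k = p g" using surj by blast
  then show "w k = w' k" using fun_cong[OF eq, of g] by (simp add: pull_def)
qed

text \<open>In characteristic two a vanishing fiber sum x(g) + x(g c) says that x is constant on
  fibers, so \<open>w\<close> can be read off along a section of \<open>p\<close>.\<close>

lemma push_eq_0E:
  assumes x: "x \<in> ga G" "push x = 0"
  obtains w where "w \<in> ga K" "x = pull w"
proof -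
  define s where "s = inv_into (carrier G) p"
  define w where "w = (\<lambda>k. if k \<in> carrier K then x (s k) else 0)"
  have w: "w \<in> ga K" by (simp add: ga_def w_def)
  have "x = pull w"
  proof (rule G.ga_eqI)
    fix g assume g: "g \<in> carrier G"
    have "p (s (p g)) = p g" "s (p g) \<in> carrier G"
      unfolding s_def using g by (auto intro!: f_inv_into_f inv_into_into)
    then have "s (p g) = g \<or> s (p g) = g \<otimes> c" using g p_eqD by blast
    moreover have "x g + x (g \<otimes> c) = 0"
      using push_p[OF g, of x] x(2) by simp
    then have "x (g \<otimes> c) = x g" using char_two_add_eq_0_iff[OF char] by metis
    ultimately show "x g = pull w g" using g by (auto simp: pull_def w_def)
  qed (use x in simp_all)
  with w show thesis by (rule that)
qed

text \<open>The preimage carries the coefficients of \<open>v\<close> on one chosen point of each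
  fiber and is zero elsewhere.\<close>

lemma push_surjE:
  assumes v: "v \<in> ga K"
  obtains u where "u \<in> ga G" "push u = v"
proof -
  define s where "s = inv_into (carrier G) p"
  define u where "u = (\<lambda>g. if g \<in> carrier G \<and> g = s (p g) then v (p g) else 0)"
  have u: "u \<in> ga G" by (simp add: ga_def u_def)
  have "push u = v"
  proof (rule K.ga_eqI)
    fix k assume k: "k \<in> carrier K"
    have s: "p (s k) = k" "s k \<in> carrier G"
      unfolding s_def using k surj by (auto intro!: f_inv_into_f inv_into_into)
    have "push u k = (\<Sum>g\<in>{g \<in> carrier G. p g = k}. if g = s k then v k else 0)"
      using k by (auto simp: push_def u_def intro!: sum.cong)
    also have "\<dots> = v k" using s by simp
    finally show "push u k = v k" .
  qed (use v in simp_all)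
  with u show thesis by (rule that)
qed

lemma push_sgl:
  assumes "g \<in> carrier G"
  shows "push (sgl g a) = sgl (p g) a"
proof (rule K.ga_eqI)
  fix k assume "k \<in> carrier K"
  then show "push (sgl g a) k = sgl (p g) a k"
    using assms by (auto simp: push_def sgl_def)
qed (use assms in simp_all)

lemma push_star: "push (star G x) = star K (push x)"
proof (rule K.ga_eqI)
  fix k assume k: "k \<in> carrier K"
  have "(\<Sum>g\<in>{g \<in> carrier G. p g = k}. star G x g)
    = (\<Sum>g\<in>{g \<in> carrier G. p g = inv\<^bsub>K\<^esub> k}. x g)"
    by (rule sum.reindex_bij_witness[where i = "m_inv G" and j = "m_inv G"])
      (use k in \<open>auto simp: star_def\<close>)
  then show "push (star G x) k = star K (push x) k"
    using k by (simp add: push_def star_def)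
qed simp_all

lemma pull_star: "star G (pull w) = pull (star K w)"
  by (auto simp: pull_def star_def fun_eq_iff)

text \<open>Summation along fibers; it turns convolutions over the larger group into convolutions
  over the quotient in \<open>conv_pull\<close> and \<open>push_conv\<close>.\<close>

lemma sum_push: "(\<Sum>g\<in>carrier G. x g * f (p g)) = (\<Sum>k\<in>carrier K. push x k * f k)"
proof -
  have "(\<Sum>g\<in>carrier G. x g * f (p g))
    = (\<Sum>k\<in>carrier K. \<Sum>g\<in>{g \<in> carrier G. p g = k}. x g * f (p g))"
    by (rule sum.group[symmetric]) auto
  also have "\<dots> = (\<Sum>k\<in>carrier K. push x k * f k)"
    by (intro sum.cong) (auto simp: push_def sum_distrib_right)
  finally show ?thesis .
qed

text \<open>F G acts on the kernel of \<open>push\<close> through F K, because the coefficients of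
  \<open>pull w\<close> depend on the image under \<open>p\<close> alone. The version for the other
  side follows by applying the involution.\<close>

lemma conv_pull: "x \<star> pull w = pull (push x \<star>\<^bsub>K\<^esub> w)"
proof (rule G.ga_eqI)
  fix g assume g: "g \<in> carrier G"
  have "(x \<star> pull w) g = (\<Sum>h\<in>carrier G. x h * w (inv\<^bsub>K\<^esub> p h \<otimes>\<^bsub>K\<^esub> p g))"
    using g by (auto simp: conv_def pull_def intro!: sum.cong)
  also have "\<dots> = pull (push x \<star>\<^bsub>K\<^esub> w) g"
    using g by (simp add: sum_push[of x "\<lambda>k. w (inv\<^bsub>K\<^esub> k \<otimes>\<^bsub>K\<^esub> p g)"] pull_def conv_def)
  finally show "(x \<star> pull w) g = pull (push x \<star>\<^bsub>K\<^esub> w) g" .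
qed simp_all

lemma pull_conv:
  assumes "x \<in> ga G" "w \<in> ga K"
  shows "pull w \<star> x = pull (w \<star>\<^bsub>K\<^esub> push x)"
proof -
  have "star G (star G x \<star> star G (pull w)) = star G (pull (push (star G x) \<star>\<^bsub>K\<^esub> star K w))"
    by (simp only: pull_star conv_pull)
  then show ?thesis
    using assms by (simp add: G.star_conv K.star_conv pull_star push_star G.star_star K.star_star)
qed

lemma push_conv: "push (x \<star> y) = push x \<star>\<^bsub>K\<^esub> push y"
proof (rule K.ga_eqI)
  fix k assume k: "k \<in> carrier K"
  have fib: "(\<Sum>g\<in>{g \<in> carrier G. p g = k}. y (inv h \<otimes> g)) = push y (inv\<^bsub>K\<^esub> p h \<otimes>\<^bsub>K\<^esub> k)"
    if h: "h \<in> carrier G" for h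
  proof -
    have "(\<Sum>g\<in>{g \<in> carrier G. p g = k}. y (inv h \<otimes> g))
      = (\<Sum>g\<in>{g \<in> carrier G. p g = inv\<^bsub>K\<^esub> p h \<otimes>\<^bsub>K\<^esub> k}. y g)"
      by (rule sum.reindex_bij_witness[where i = "\<lambda>g. h \<otimes> g" and j = "\<lambda>g. inv h \<otimes> g"])
        (use h k in \<open>auto simp flip: G.m_assoc K.m_assoc\<close>)
    then show ?thesis using h k by (simp add: push_def)
  qed
  have "push (x \<star> y) k
      = (\<Sum>g\<in>{g \<in> carrier G. p g = k}. \<Sum>h\<in>carrier G. x h * y (inv h \<otimes> g))"
    using k by (simp add: push_def conv_def)
  also have "\<dots> = (\<Sum>h\<in>carrier G. \<Sum>g\<in>{g \<in> carrier G. p g = k}. x h * y (inv h \<otimes> g))"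
    by (rule sum.swap)
  also have "\<dots> = (\<Sum>h\<in>carrier G. x h * push y (inv\<^bsub>K\<^esub> p h \<otimes>\<^bsub>K\<^esub> k))"
    by (simp add: sum_distrib_left[symmetric] fib)
  also have "\<dots> = (push x \<star>\<^bsub>K\<^esub> push y) k"
    using k by (simp add: sum_push[of x "\<lambda>l. push y (inv\<^bsub>K\<^esub> l \<otimes>\<^bsub>K\<^esub> k)"] conv_def)
  finally show "push (x \<star> y) k = (push x \<star>\<^bsub>K\<^esub> push y) k" .
qed simp_all

lemma pull_zero: "pull 0 = 0"
  by (auto simp: pull_def)

text \<open>The kernel of \<open>push\<close> has square zero by \<open>conv_pull\<close> and
  \<open>push_pull\<close>, so only the two cross terms of the product survive.\<close>

lemma conv_star_add_pull:
  assumes u: "u \<in> ga G" and z: "z \<in> ga K"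
  shows "(u + pull z) \<star> star G (u + pull z)
    = u \<star> star G u + pull (push u \<star>\<^bsub>K\<^esub> star K z + z \<star>\<^bsub>K\<^esub> star K (push u))"
proof -
  have "pull z \<star> pull (star K z) = 0"
    by (simp add: conv_pull push_pull) (simp add: conv_def pull_def fun_eq_iff)
  moreover have "pull z \<star> star G u = pull (z \<star>\<^bsub>K\<^esub> star K (push u))"
    using z by (simp add: pull_conv push_star)
  moreover have "u \<star> pull (star K z) = pull (push u \<star>\<^bsub>K\<^esub> star K z)"
    by (rule conv_pull)
  ultimately show ?thesis
    by (simp add: G.star_add G.conv_add_left G.conv_add_right pull_star pull_add ac_simps)
qed

section \<open>Fibers and image of \<open>push\<close> on unitary units\<close>

abbreviation "UG \<equiv> (unitary_units G :: ('g \<Rightarrow> 'f) set)"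
abbreviation "UK \<equiv> (unitary_units K :: ('k \<Rightarrow> 'f) set)"

lemmas UG_eq = G.unitary_units_eq[OF char]
lemmas UK_eq = K.unitary_units_eq[OF char]

lemma push_unitary: "u \<in> UG \<Longrightarrow> push u \<in> UK"
  unfolding UG_eq UK_eq by (simp add: push_star[symmetric] push_conv[symmetric] push_sgl)

lemma unitary_conv_star:
  assumes "v \<in> UK"
  shows "v \<in> ga K" "v \<star>\<^bsub>K\<^esub> star K v = sgl \<one>\<^bsub>K\<^esub> 1" "star K v \<star>\<^bsub>K\<^esub> v = sgl \<one>\<^bsub>K\<^esub> 1"
  using assms K.conv_eq_one_commute[of v "star K v"] by (simp_all add: UK_eq)

text \<open>The lifts of \<open>v = push u\<close> are the \<open>u + pull z\<close>. By
  \<open>conv_star_add_pull\<close> such a lift is unitary exactly when z times the adjoint of v is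
  self-adjoint, that is, when z = y v with y self-adjoint, because v is unitary. Hence the fiber is
  in bijection with the self-adjoint elements of F K.\<close>

lemma card_unitary_fiber:
  assumes u: "u \<in> UG"
  shows "card {x \<in> UG. push x = push u} = CARD('f) ^ ((order K + card (square_one_elements K)) div 2)"
proof -
  let ?Y = "{y \<in> ga K. star K y = (y :: 'k \<Rightarrow> 'f)}"
  define v where "v = push u"
  have v: "v \<in> ga K" "v \<star>\<^bsub>K\<^esub> star K v = sgl \<one>\<^bsub>K\<^esub> 1" "star K v \<star>\<^bsub>K\<^esub> v = sgl \<one>\<^bsub>K\<^esub> 1"
    using unitary_conv_star[OF push_unitary[OF u]] by (simp_all add: v_def)
  have u': "u \<in> ga G" "u \<star> star G u = sgl \<one> 1" using u by (simp_all add: UG_eq)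
  have mem: "u + pull z \<in> UG \<longleftrightarrow> z \<star>\<^bsub>K\<^esub> star K v = star K (z \<star>\<^bsub>K\<^esub> star K v)" if z: "z \<in> ga K" for z
  proof -
    have st: "star K (z \<star>\<^bsub>K\<^esub> star K v) = v \<star>\<^bsub>K\<^esub> star K z" using v by (simp add: K.star_conv K.star_star)
    have "u + pull z \<in> UG \<longleftrightarrow> pull (v \<star>\<^bsub>K\<^esub> star K z + z \<star>\<^bsub>K\<^esub> star K v) = 0"
      using u' z by (simp add: UG_eq conv_star_add_pull v_def)
    also have "\<dots> \<longleftrightarrow> v \<star>\<^bsub>K\<^esub> star K z + z \<star>\<^bsub>K\<^esub> star K v = 0"
      using pull_inj[of "v \<star>\<^bsub>K\<^esub> star K z + z \<star>\<^bsub>K\<^esub> star K v" 0] pull_zero by (auto simp: ga_def conv_def)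
    also have "\<dots> \<longleftrightarrow> z \<star>\<^bsub>K\<^esub> star K v = v \<star>\<^bsub>K\<^esub> star K z"
      by (auto simp: fun_eq_iff char_two_add_eq_0_iff[OF char])
    finally show ?thesis by (simp add: st)
  qed
  have inv1: "y \<star>\<^bsub>K\<^esub> v \<star>\<^bsub>K\<^esub> star K v = y" if "y \<in> ga K" for y
    using that v by (simp add: K.conv_assoc K.conv_one)
  have "inj_on (\<lambda>y. u + pull (y \<star>\<^bsub>K\<^esub> v)) ?Y"
  proof (rule inj_onI)
    fix x y assume xy: "x \<in> ?Y" "y \<in> ?Y" "u + pull (x \<star>\<^bsub>K\<^esub> v) = u + pull (y \<star>\<^bsub>K\<^esub> v)"
    then have "x \<star>\<^bsub>K\<^esub> v = y \<star>\<^bsub>K\<^esub> v" using pull_inj[of "x \<star>\<^bsub>K\<^esub> v" "y \<star>\<^bsub>K\<^esub> v"] by simp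
    then have "x \<star>\<^bsub>K\<^esub> v \<star>\<^bsub>K\<^esub> star K v = y \<star>\<^bsub>K\<^esub> v \<star>\<^bsub>K\<^esub> star K v" by (rule arg_cong)
    moreover have "x \<in> ga K" "y \<in> ga K" using xy(1,2) by auto
    ultimately show "x = y" by (simp only: inv1)
  qed
  moreover have "(\<lambda>y. u + pull (y \<star>\<^bsub>K\<^esub> v)) ` ?Y = {x \<in> UG. push x = v}"
  proof (intro equalityI subsetI)
    fix x assume "x \<in> (\<lambda>y. u + pull (y \<star>\<^bsub>K\<^esub> v)) ` ?Y"
    then obtain y where y: "y \<in> ?Y" "x = u + pull (y \<star>\<^bsub>K\<^esub> v)" by blast
    then show "x \<in> {x \<in> UG. push x = v}"
      using mem[of "y \<star>\<^bsub>K\<^esub> v"] inv1[of y] by (simp add: push_add push_pull v_def)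
  next
    fix x assume x: "x \<in> {x \<in> UG. push x = v}"
    then have "push (x + u) = 0" by (simp add: push_add v_def add_self)
    moreover have "x + u \<in> ga G" using x u' by (simp add: UG_eq)
    ultimately obtain z where z: "z \<in> ga K" "x + u = pull z"
      using push_eq_0E[of "x + u"] by blast
    have xz: "x = u + pull z" unfolding z(2)[symmetric] add.commute[of x u] add_self_left ..
    have zv: "z \<star>\<^bsub>K\<^esub> star K v \<star>\<^bsub>K\<^esub> v = z" using z(1) v by (simp add: K.conv_assoc K.conv_one)
    have "x \<in> UG" using x by blast
    then have "u + pull z \<in> UG" by (simp only: xz[symmetric])
    then have "z \<star>\<^bsub>K\<^esub> star K v \<in> ?Y" using mem[OF z(1)] by simp
    then show "x \<in> (\<lambda>y. u + pull (y \<star>\<^bsub>K\<^esub> v)) ` ?Y"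
      by (rule rev_image_eqI) (simp only: zv xz)
  qed
  ultimately have "card {x \<in> UG. push x = v} = card ?Y"
    using card_image[of "\<lambda>y. u + pull (y \<star>\<^bsub>K\<^esub> v)" ?Y] by argo
  then show ?thesis
    unfolding v_def K.card_self_adjoint K.square_one_elements_eq order_def .
qed

lemma finite_unitary: "finite UG" "finite UK"
  by (simp_all add: UG_eq UK_eq)

lemma card_unitary:
  "card UG = CARD('f) ^ ((order K + card (square_one_elements K)) div 2) * card (push ` UG)"
proof -
  have "card UG = (\<Sum>v\<in>push ` UG. card {x \<in> UG. push x = v})"
    using finite_unitary sum.image_gen[of UG "\<lambda>_. 1::nat" push] by simp
  also have "\<dots> = (\<Sum>v\<in>push ` UG. CARD('f) ^ ((order K + card (square_one_elements K)) div 2))"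
    by (intro sum.cong) (auto simp: card_unitary_fiber)
  finally show ?thesis by simp
qed

text \<open>The product of \<open>u\<close> with its adjoint and the identity have the same image in
  F K, so they differ by some \<open>pull w\<close>; \<open>w\<close> inherits self-adjointness
  because \<open>pull\<close> is injective and commutes with the involution.\<close>

lemma conv_star_lift:
  assumes u: "u \<in> ga G" "push u \<in> UK"
  obtains w where "w \<in> ga K" "star K w = w" "u \<star> star G u = sgl \<one> 1 + pull w"
proof -
  have "push (u \<star> star G u + sgl \<one> 1) = 0"
    using u(2) by (simp add: push_add push_conv push_star UK_eq push_sgl add_self)
  then obtain w where w: "w \<in> ga K" "u \<star> star G u + sgl \<one> 1 = pull w"
    using push_eq_0E[OF G.add_in_ga[OF G.conv_in_ga G.sgl_in_ga[OF G.one_closed]]] by blast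
  have "pull (star K w) = pull w"
    unfolding pull_star[symmetric] w(2)[symmetric]
    using u(1) by (simp add: G.star_add G.star_conv G.star_star G.star_one)
  then have "star K w = w" using w(1) pull_inj by simp
  moreover have "u \<star> star G u = sgl \<one> 1 + pull w"
    unfolding w(2)[symmetric] by (simp only: add.commute[of "u \<star> star G u"] add_self_left)
  ultimately show thesis using w(1) that by blast
qed

text \<open>Replacing \<open>u\<close> by \<open>u + pull z\<close> changes the error
  \<open>w\<close> by s + \<open>star K s\<close>, where s is z times the adjoint of
  \<open>push u\<close>. Thus \<open>w\<close> must be written as y + \<open>star K y\<close>, which
  is possible when it vanishes on self-inverse elements, and z = y \<open>push u\<close> then
  cancels it.\<close>

lemma unitary_lift:
  assumes u: "u \<in> ga G" "push u \<in> UK"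
    and zero: "\<And>g. g \<in> carrier G \<Longrightarrow> g \<noteq> \<one> \<Longrightarrow> inv\<^bsub>K\<^esub> p g = p g \<Longrightarrow> (u \<star> star G u) g = 0"
  shows "push u \<in> push ` UG"
proof -
  let ?v = "push u"
  have v: "?v \<in> ga K" "?v \<star>\<^bsub>K\<^esub> star K ?v = sgl \<one>\<^bsub>K\<^esub> 1"
    using unitary_conv_star[OF u(2)] by simp_all
  obtain w where w: "w \<in> ga K" "star K w = w" "u \<star> star G u = sgl \<one> 1 + pull w"
    using conv_star_lift[OF u] .
  have "w k = 0" if k: "k \<in> carrier K" "inv\<^bsub>K\<^esub> k = k" for k
  proof -
    \<comment> \<open>The hypothesis \<open>zero\<close> says nothing at the identity of the group,
      where the coefficient of the identity element interferes; over the trivial element of the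
      quotient the point \<open>c\<close> is used instead.\<close>
    obtain g where g: "g \<in> carrier G" "g \<noteq> \<one>" "p g = k"
    proof (cases "k = \<one>\<^bsub>K\<^esub>")
      case True then show thesis using that[of c] c_neq_one by simp
    next
      case False
      obtain g where g: "g \<in> carrier G" "k = p g" using p_surjE[OF k(1)] .
      with False show thesis by (intro that[of g]) auto
    qed
    have "(u \<star> star G u) g = w k" unfolding w(3) using g by (simp add: sgl_def pull_def)
    then show ?thesis using zero[OF g(1,2)] g(3) k(2) by simp
  qed
  then obtain y where y: "y \<in> ga K" "w = y + star K y"
    using K.self_adjoint_decompose[OF w(1,2)] by blast
  let ?z = "y \<star>\<^bsub>K\<^esub> ?v"
  have z: "?z \<star>\<^bsub>K\<^esub> star K ?v = y" using v y(1) by (simp add: K.conv_assoc K.conv_one)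
  then have "?v \<star>\<^bsub>K\<^esub> star K ?z = star K y" using v K.star_conv[of ?z "star K ?v"] by (simp add: K.star_star)
  then have "push u \<star>\<^bsub>K\<^esub> star K ?z + ?z \<star>\<^bsub>K\<^esub> star K (push u) = w"
    using z y(2) by (simp add: add.commute)
  then have "(u + pull ?z) \<star> star G (u + pull ?z) = sgl \<one> 1 + (pull w + pull w)"
    using u(1) by (simp only: conv_star_add_pull K.conv_in_ga w(3) add.assoc)
  then have "u + pull ?z \<in> UG" using u(1) by (simp add: UG_eq add_self)
  moreover have "push (u + pull ?z) = push u" by (simp add: push_add push_pull)
  ultimately show ?thesis by (metis imageI)
qed

text \<open>By \<open>sq\<close> every point over a self-inverse element squares to one, so the
  relevant coefficients vanish by \<open>conv_star_apply_involution\<close> and every unitary unit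
  lifts. Also by \<open>sq\<close>, the elements of square one upstairs are the full preimage of
  those downstairs, so both the order and their number double, and with them the exponent
  \<open>?e\<close>, as the fiber size requires.\<close>

theorem unitary_formula_lift:
  assumes sq: "\<And>g. g \<in> carrier G \<Longrightarrow> inv\<^bsub>K\<^esub> p g = p g \<Longrightarrow> inv g = g"
    and K: "unitary_formula K F"
  shows "unitary_formula G F"
proof -
  let ?q = "CARD('f)" and ?e = "(order K + card (square_one_elements K)) div 2"
  have "push ` UG = UK"
  proof (intro equalityI subsetI)
    fix v assume v: "v \<in> UK"
    obtain u where u: "u \<in> ga G" "push u = v"
      using push_surjE[OF unitary_conv_star(1)[OF v]] .
    have "push u \<in> push ` UG"
    proof (rule unitary_lift)
      fix g assume g: "g \<in> carrier G" "g \<noteq> \<one>" "inv\<^bsub>K\<^esub> p g = p g"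
      then have "g \<otimes> g = \<one>" using sq[of g] G.r_inv[of g] by simp
      then show "(u \<star> star G u) g = 0"
        using g by (intro G.conv_star_apply_involution[OF char])
    qed (use u v in auto)
    then show "v \<in> push ` UG" using u by simp
  qed (use push_unitary in blast)
  then have "card UG * ?q = ?q ^ ?e * (card UK * ?q)" using card_unitary by simp
  also have "\<dots> = 2 * ?q ^ (?e + ?e)"
    using K by (simp add: unitary_formula_def power_add)
  also have "?e + ?e = (order G + card (square_one_elements G)) div 2"
  proof -
    have "square_one_elements G = {g \<in> carrier G. p g \<in> square_one_elements K}"
      unfolding G.square_one_elements_eq K.square_one_elements_eq using sq by (auto simp flip: p_inv)
    then have "card (square_one_elements G) = 2 * card (square_one_elements K)"
      using card_preimage[of "square_one_elements K"] K.square_one_elements_eq by simp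
    moreover have "{g \<in> carrier G. p g \<in> carrier K} = carrier G" by auto
    then have "order G = 2 * order K"
      using card_preimage[of "carrier K"] by (simp add: order_def)
    ultimately show ?thesis using K.even_order_add_card_square_one by presburger
  qed
  finally show ?thesis by (simp add: unitary_formula_def)
qed

text \<open>Two lifts differ by some \<open>pull z\<close>, which changes the product with the
  adjoint by \<open>pull\<close> of an element s + \<open>star K s\<close>; over a self-inverse
  point its two summands agree and cancel. This makes the obstruction in the next lemma a function
  of the unitary unit downstairs.\<close>

lemma conv_star_lift_indep:
  assumes u: "u \<in> ga G" "u' \<in> ga G" "push u' = push u"
    and t: "t \<in> carrier G" "inv\<^bsub>K\<^esub> p t = p t"
  shows "(u' \<star> star G u') t = (u \<star> star G u) t"
proof -
  have "push (u + u') = 0" using u(3) by (simp add: push_add add_self)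
  then obtain z where z: "z \<in> ga K" "u + u' = pull z"
    using push_eq_0E[OF G.add_in_ga[OF u(1,2)]] by blast
  then have u': "u' = u + pull z" by (simp add: add_self_left flip: z(2))
  have "z \<star>\<^bsub>K\<^esub> star K (push u) = star K (push u \<star>\<^bsub>K\<^esub> star K z)"
    using z(1) by (simp add: K.star_conv K.star_star)
  then have "(push u \<star>\<^bsub>K\<^esub> star K z + z \<star>\<^bsub>K\<^esub> star K (push u)) (p t) = 0"
    using t char_two_add_self[OF char] by (simp only: plus_fun_apply star_def p_closed if_True)
  then show ?thesis
    unfolding u' conv_star_add_pull[OF u(1) z(1)] using t by (simp add: pull_def)
qed

text \<open>
  When a single inverse-closed fiber over an involution of \<open>K\<close> consists of non-involutions,
  the coefficient of \<open>u u\<^sup>*\<close> at its point \<open>t\<close> is the only obstruction to lifting, and it is a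
  homomorphism from the unitary units of the quotient to the additive group of the field.
\<close>

lemma card_unitary_obstruction:
  assumes t: "t \<in> carrier G" "inv\<^bsub>K\<^esub> p t = p t" "t \<noteq> \<one>"
    and single: "\<And>g. g \<in> carrier G \<Longrightarrow> inv\<^bsub>K\<^esub> p g = p g \<Longrightarrow> inv g = g \<or> g = t \<or> g = inv t"
    and comm: "\<And>g h. g \<in> carrier K \<Longrightarrow> h \<in> carrier K \<Longrightarrow> g \<otimes>\<^bsub>K\<^esub> h = h \<otimes>\<^bsub>K\<^esub> g"
    and attained: "\<And>a. \<exists>u \<in> ga G. push u \<in> UK \<and> (u \<star> star G u) t = a"
  shows "card UK = CARD('f) * card (push ` UG)"
proof -
  define s where "s v = (SOME u. u \<in> ga G \<and> push u = v)" for v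
  define ob where "ob v = (s v \<star> star G (s v)) t" for v
  have ob: "ob (push u) = (u \<star> star G u) t" if u: "u \<in> ga G" for u
  proof -
    have "s (push u) \<in> ga G \<and> push (s (push u)) = push u"
      unfolding s_def by (rule someI[of _ u]) (simp add: u)
    then show ?thesis unfolding ob_def using u t by (intro conv_star_lift_indep) auto
  qed
  have lift: "\<exists>u \<in> ga G. push u = v" if "v \<in> UK" for v
    using push_surjE[OF unitary_conv_star(1)[OF that]] by blast
  have ob_mult: "v \<star>\<^bsub>K\<^esub> v' \<in> UK \<and> ob (v \<star>\<^bsub>K\<^esub> v') = ob v + ob v'" if v: "v \<in> UK" "v' \<in> UK" for v v'
  proof -
    obtain u u' where u: "u \<in> ga G" "push u = v" and u': "u' \<in> ga G" "push u' = v'"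
      using lift v by meson
    obtain w where w: "w \<in> ga K" "u' \<star> star G u' = sgl \<one> 1 + pull w"
      using conv_star_lift[of u'] u' v(2) by metis
    have "(u \<star> u') \<star> star G (u \<star> u') = u \<star> (u' \<star> star G u') \<star> star G u"
      by (simp add: G.star_conv G.conv_assoc)
    also have "\<dots> = u \<star> star G u + pull (v \<star>\<^bsub>K\<^esub> w \<star>\<^bsub>K\<^esub> star K v)"
      using u w(1)
      by (simp add: w(2) G.conv_add_left G.conv_add_right G.conv_one conv_pull pull_conv push_star)
    \<comment> \<open>Commutativity of F K moves v past w, so that v meets its adjoint and
      disappears; this is what makes the obstruction additive.\<close>
    also have "v \<star>\<^bsub>K\<^esub> w \<star>\<^bsub>K\<^esub> star K v = w \<star>\<^bsub>K\<^esub> (v \<star>\<^bsub>K\<^esub> star K v)"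
      using K.conv_commute[OF comm, of v w] by (simp add: K.conv_assoc)
    also have "\<dots> = w" using unitary_conv_star[OF v(1)] w(1) by (simp add: K.conv_one)
    finally have eq: "(u \<star> u') \<star> star G (u \<star> u') = u \<star> star G u + pull w" .
    have "ob (v \<star>\<^bsub>K\<^esub> v') = ((u \<star> u') \<star> star G (u \<star> u')) t"
      using ob[of "u \<star> u'"] u(2) u'(2) by (simp add: push_conv)
    also have "\<dots> = ob v + ob v'"
      using ob[OF u(1)] ob[OF u'(1)] u(2) u'(2) t by (simp add: eq w(2) sgl_def)
    finally have "ob (v \<star>\<^bsub>K\<^esub> v') = ob v + ob v'" .
    moreover have "v \<star>\<^bsub>K\<^esub> v' \<in> UK"
    proof -
      have "(v \<star>\<^bsub>K\<^esub> v') \<star>\<^bsub>K\<^esub> star K (v \<star>\<^bsub>K\<^esub> v') = v \<star>\<^bsub>K\<^esub> (v' \<star>\<^bsub>K\<^esub> star K v') \<star>\<^bsub>K\<^esub> star K v"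
        by (simp add: K.star_conv K.conv_assoc)
      then show ?thesis
        using unitary_conv_star[OF v(1)] unitary_conv_star[OF v(2)] by (simp add: UK_eq K.conv_one)
    qed
    ultimately show ?thesis by simp
  qed
  \<comment> \<open>Multiplication by a unitary element of obstruction a embeds the fiber over b
    into the fiber over b + a. Since a + a = 0, the cases b = 0 and b = a show that all fibers have
    the same size.\<close>
  have fiber_le: "card {v \<in> UK. ob v = b} \<le> card {v \<in> UK. ob v = b + a}" for a b
  proof -
    obtain u where u: "u \<in> ga G" "push u \<in> UK" "(u \<star> star G u) t = a" using attained by blast
    let ?v = "push u"
    have "inj_on (\<lambda>v. v \<star>\<^bsub>K\<^esub> ?v) {v \<in> UK. ob v = b}"
      by (rule inj_on_inverseI[of _ "\<lambda>v. v \<star>\<^bsub>K\<^esub> star K ?v"])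
        (use unitary_conv_star[OF u(2)] in \<open>simp add: K.conv_assoc K.conv_one UK_eq\<close>)
    moreover have "(\<lambda>v. v \<star>\<^bsub>K\<^esub> ?v) ` {v \<in> UK. ob v = b} \<subseteq> {v \<in> UK. ob v = b + a}"
      using ob_mult[OF _ u(2)] ob[OF u(1)] u(3) by auto
    ultimately show ?thesis by (rule card_inj_on_le) (simp add: finite_unitary)
  qed
  have fiber: "card {v \<in> UK. ob v = a} = card {v \<in> UK. ob v = 0}" for a
    using fiber_le[of 0 a] fiber_le[of a a]
    by (simp only: char_two_add_self[OF char, of a] add_0_left le_antisym)
  have "UK = (\<Union>a. {v \<in> UK. ob v = a})" by auto
  then have "card UK = card (\<Union>a. {v \<in> UK. ob v = a})" by simp
  also have "\<dots> = (\<Sum>a\<in>UNIV. card {v \<in> UK. ob v = a})"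
    by (rule card_UN_disjoint) (auto simp: finite_unitary)
  also have "\<dots> = (\<Sum>a\<in>(UNIV :: 'f set). card {v \<in> UK. ob v = 0})"
    by (rule sum.cong[OF HOL.refl fiber])
  also have "\<dots> = CARD('f) * card {v \<in> UK. ob v = 0}" by simp
  also have "{v \<in> UK. ob v = 0} = push ` UG"
  proof (intro equalityI subsetI)
    fix v assume "v \<in> push ` UG"
    then obtain u where u: "u \<in> UG" "v = push u" by blast
    then have u': "u \<in> ga G" "u \<star> star G u = sgl \<one> 1" by (simp_all add: UG_eq)
    then have "ob v = 0" using ob[OF u'(1)] t u(2) by (simp add: sgl_def)
    then show "v \<in> {v \<in> UK. ob v = 0}" using push_unitary[OF u(1)] u(2) by simp
  next
    fix v assume v: "v \<in> {v \<in> UK. ob v = 0}"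
    then obtain u where u: "u \<in> ga G" "push u = v" using lift by blast
    then have ut: "(u \<star> star G u) t = 0" using ob v by auto
    have "push u \<in> push ` UG"
    proof (rule unitary_lift)
      fix g assume g: "g \<in> carrier G" "g \<noteq> \<one>" "inv\<^bsub>K\<^esub> p g = p g"
      consider "inv g = g" | "g = t" | "g = inv t" using single g by blast
      then show "(u \<star> star G u) g = 0"
      proof cases
        case 1
        then have "g \<otimes> g = \<one>" using G.r_inv[OF g(1)] by simp
        then show ?thesis using g by (intro G.conv_star_apply_involution[OF char])
      next
        case 2 then show ?thesis using ut by simp
      next
        case 3
        \<comment> \<open>The product of u with its adjoint is self-adjoint, so its coefficients at
          t and at the inverse of t agree and both vanish.\<close>
        have "star G (u \<star> star G u) g = (u \<star> star G u) t" using 3 t by (simp add: star_def)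
        then show ?thesis using ut u(1) by (simp add: G.star_conv G.star_star)
      qed
    qed (use u v in auto)
    then show "v \<in> push ` UG" using u by simp
  qed
  finally show ?thesis .
qed

end

section \<open>Cyclic groups\<close>

lemma finite_group_integer_mod_group: "0 < n \<Longrightarrow> finite_group (integer_mod_group n)"
  unfolding finite_group_def finite_group_axioms_def by (simp add: carrier_integer_mod_group)

lemma double_cover_integer_mod_group:
  assumes "0 < n" "CHAR('f::{field,finite}) = 2"
  shows "double_cover TYPE('f) (integer_mod_group (2 * n)) (integer_mod_group n) (\<lambda>x. x mod int n) (int n)"
proof -
  interpret G: finite_group "integer_mod_group (2 * n)"
    by (rule finite_group_integer_mod_group) (use assms in simp)
  interpret K: finite_group "integer_mod_group n"
    by (rule finite_group_integer_mod_group) (use assms in simp)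
  show ?thesis
  proof
    show "(\<lambda>x. x mod int n) \<in> hom (integer_mod_group (2 * n)) (integer_mod_group n)"
      using assms(1) by (auto simp: hom_def carrier_integer_mod_group mod_mod_cancel mod_simps)
    show "(\<lambda>x. x mod int n) ` carrier (integer_mod_group (2 * n)) = carrier (integer_mod_group n)"
    proof (intro equalityI subsetI)
      fix x assume "x \<in> carrier (integer_mod_group n)"
      then show "x \<in> (\<lambda>x. x mod int n) ` carrier (integer_mod_group (2 * n))"
        using assms(1) by (intro image_eqI[of _ _ x]) (auto simp: carrier_integer_mod_group)
    qed (use assms(1) in \<open>auto simp: carrier_integer_mod_group\<close>)
    have "x = 0 \<or> x = int n" if "0 \<le> x" "x < 2 * int n" "int n dvd x" for x
    proof -
      obtain k where k: "x = int n * k" using \<open>int n dvd x\<close> by auto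
      with that have "0 \<le> int n * k" "int n * k < int n * 2" by (simp_all add: mult.commute)
      then have "0 \<le> k" "k < 2" using assms(1) by (simp_all add: zero_le_mult_iff)
      then have "k = 0 \<or> k = 1" by auto
      then show ?thesis using k by auto
    qed
    then show "{g \<in> carrier (integer_mod_group (2 * n)). g mod int n = \<one>\<^bsub>integer_mod_group n\<^esub>}
        = {\<one>\<^bsub>integer_mod_group (2 * n)\<^esub>, int n}"
      using assms(1) by (auto simp: carrier_integer_mod_group)
    show "int n \<noteq> \<one>\<^bsub>integer_mod_group (2 * n)\<^esub>" using assms(1) by simp
  qed (fact assms(2))
qed

lemma integer_mod_group_inv_eq_self:
  assumes n: "0 < n" and x: "x \<in> carrier (integer_mod_group (2 * n))"
  shows "inv\<^bsub>integer_mod_group (2 * n)\<^esub> x = x \<longleftrightarrow> x = 0 \<or> x = int n"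
proof -
  have x': "0 \<le> x" "x < 2 * int n" using n x by (auto simp: carrier_integer_mod_group)
  show ?thesis
  proof (cases "x = 0")
    case False
    then have "(- x) mod (2 * int n) = 2 * int n - x"
      using x' by (intro int_mod_pos_eq[of _ _ "-1"]) auto
    then show ?thesis using x False by auto
  qed (use x in simp)
qed

lemma order_integer_mod_group: "0 < n \<Longrightarrow> order (integer_mod_group n) = n"
  by (simp add: order_def carrier_integer_mod_group)

lemma card_square_one_integer_mod_group:
  assumes n: "0 < n"
  shows "card (square_one_elements (integer_mod_group (2 * n))) = 2"
proof -
  interpret finite_group "integer_mod_group (2 * n)"
    by (rule finite_group_integer_mod_group) (use assms in simp)
  have "square_one_elements (integer_mod_group (2 * n)) = {0, int n}"
    unfolding square_one_elements_eq using n integer_mod_group_inv_eq_self[OF n]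
    by (auto simp: carrier_integer_mod_group)
  then show ?thesis using n by simp
qed

text \<open>Written out, the product of x with its adjoint has coefficient (x0 + x1 + x2 + x3)^2 at
  0, (x0 + x2) (x1 + x3) at 1 and 3, and 0 at 2. So x is unitary iff one of x0 + x2 and x1 + x3 is 1
  and the other is 0, which leaves 2 |F|^2 elements.\<close>

lemma unitary_formula_cyclic_4:
  assumes char: "CHAR('f::{field,finite}) = 2"
  shows "unitary_formula (integer_mod_group 4) TYPE('f)"
proof -
  let ?G = "integer_mod_group 4"
  interpret finite_group ?G by (rule finite_group_integer_mod_group) simp
  have C: "carrier ?G = {0, 1, 2, 3}" by (auto simp: carrier_integer_mod_group)
  have inv: "inv\<^bsub>?G\<^esub> 1 = 3" "inv\<^bsub>?G\<^esub> 2 = 2" using C by simp_all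
  let ?P = "\<lambda>x :: int \<Rightarrow> 'f. x 0 + x 1 + x 2 + x 3 = 1 \<and> (x 0 + x 2) * (x 1 + x 3) = 0"
  have unitary: "x \<in> unitary_units ?G \<longleftrightarrow> x \<in> ga ?G \<and> ?P x" for x :: "int \<Rightarrow> 'f"
  proof -
    let ?y = "x \<star>\<^bsub>?G\<^esub> star ?G x"
    have y0: "?y 0 = (x 0 + x 1 + x 2 + x 3)\<^sup>2"
      using conv_star_apply_one[OF char, of x] by (simp add: C add.assoc)
    have y1: "?y 1 = (x 0 + x 2) * (x 1 + x 3)"
      using conv_star_apply[of 1 x] C by (simp add: inv algebra_simps)
    have y2: "?y 2 = 0"
      by (rule conv_star_apply_involution[OF char]) (use C in simp_all)
    have "star ?G ?y 1 = ?y 3" using C by (simp add: star_def inv)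
    moreover have "star ?G ?y = ?y" if "x \<in> ga ?G" using that by (simp add: star_conv star_star)
    ultimately have y3: "?y 3 = ?y 1" if "x \<in> ga ?G" using that by simp
    have sq: "a\<^sup>2 = 1 \<longleftrightarrow> a = 1" for a :: 'f
      using char_two_add_self[OF char, of 1] by (metis add_eq_0_iff power2_eq_1_iff)
    have "?y = sgl \<one>\<^bsub>?G\<^esub> 1 \<longleftrightarrow> (\<forall>g\<in>carrier ?G. ?y g = sgl \<one>\<^bsub>?G\<^esub> 1 g)"
      by (metis ga_eqI conv_in_ga sgl_in_ga one_closed)
    also have "\<dots> \<longleftrightarrow> ?y 0 = 1 \<and> ?y 1 = 0 \<and> ?y 2 = 0 \<and> ?y 3 = 0"
      by (simp add: C sgl_def)
    finally show ?thesis using y0 y1 y2 y3 sq by (auto simp: unitary_units_eq[OF char])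
  qed
  \<comment> \<open>The parameters are x0, x1 and the choice \<open>e\<close> of which sum equals 1:
    x0 + x2 if \<open>e\<close> holds, x1 + x3 otherwise.\<close>
  let ?f = "\<lambda>(a, b, e) g :: int. if g = 0 then a else if g = 1 then b
      else if g = 2 then a + of_bool e else if g = 3 then b + of_bool (\<not> e) else (0 :: 'f)"
  have split: "y = x + z" if "x + y = z" for x y z :: 'f
    using that char_two_add_self[OF char, of x] by (metis add.assoc add_0_left)
  have "bij_betw ?f UNIV (unitary_units ?G :: (int \<Rightarrow> 'f) set)"
    unfolding bij_betw_def
  proof
    show "inj ?f"
    proof (rule injI)
      fix x y assume eq: "?f x = ?f y"
      obtain a b e a' b' e' where xy: "x = (a, b, e)" "y = (a', b', e')" by (cases x, cases y) auto
      show "x = y"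
        using fun_cong[OF eq, of 0] fun_cong[OF eq, of 1] fun_cong[OF eq, of 2]
        by (cases e; cases e') (auto simp: xy)
    qed
    show "range ?f = unitary_units ?G"
    proof (intro equalityI subsetI)
      fix x assume "x \<in> range ?f"
      then obtain a b e where x: "x = ?f (a, b, e)" by auto
      have "a + b + (a + of_bool e) + (b + of_bool (\<not> e)) = (a + a) + (b + b) + 1"
        by (cases e) (simp_all add: ac_simps)
      moreover have "(a + (a + of_bool e)) * (b + (b + of_bool (\<not> e))) = 0"
        using char_two_add_self[OF char, of a] char_two_add_self[OF char, of b]
        by (cases e) (simp_all flip: add.assoc)
      ultimately have "?P x" using char_two_add_self[OF char, of a] char_two_add_self[OF char, of b]
        by (simp add: x)
      then show "x \<in> unitary_units ?G" unfolding unitary by (auto simp: x ga_def C)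
    next
      fix x :: "int \<Rightarrow> 'f" assume x: "x \<in> unitary_units ?G"
      have "x 0 + x 2 + (x 1 + x 3) = 1" "x 0 + x 2 = 0 \<or> x 1 + x 3 = 0"
        using x unfolding unitary by (auto simp: ac_simps)
      then obtain e where e: "x 0 + x 2 = of_bool e" "x 1 + x 3 = of_bool (\<not> e)"
        using that[of False] that[of True] by (elim disjE) simp_all
      have "x = ?f (x 0, x 1, e)"
      proof
        fix g
        show "x g = ?f (x 0, x 1, e) g"
          using x split[OF e(1)] split[OF e(2)] unfolding unitary by (auto simp: ga_def C)
      qed
      then show "x \<in> range ?f" by blast
    qed
  qed
  then have "card (unitary_units ?G :: (int \<Rightarrow> 'f) set) = CARD('f \<times> 'f \<times> bool)"
    using bij_betw_same_card by fastforce
  moreover have "order ?G = 4" "card (square_one_elements ?G) = 2"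
    using order_integer_mod_group[of 4] card_square_one_integer_mod_group[of 2] by simp_all
  ultimately show ?thesis
    by (simp add: unitary_formula_def card_cartesian_product power3_eq_cube flip: UNIV_Times_UNIV)
qed

text \<open>The self-inverse elements 0 and 2r of the quotient have the preimages 0, 4r and 2r, 6r.
  The latter two are not self-inverse but inverse to each other, so exactly the situation of
  \<open>card_unitary_obstruction\<close> arises: only one in |F| unitary units lifts. This lost
  factor matches the exponent, which is 4r + 1 instead of twice 2r + 1.\<close>

lemma unitary_formula_cyclic_double:
  assumes r: "0 < r" and char: "CHAR('f::{field,finite}) = 2"
    and K: "unitary_formula (integer_mod_group (4 * r)) TYPE('f)"
  shows "unitary_formula (integer_mod_group (8 * r)) TYPE('f)"
proof -
  let ?G = "integer_mod_group (8 * r)" and ?K = "integer_mod_group (4 * r)"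
  define R where "R = int r"
  have R: "0 < R" using r by (simp add: R_def)
  interpret double_cover ?G ?K "\<lambda>x. x mod int (4 * r)" "int (4 * r)" "TYPE('f)"
    using double_cover_integer_mod_group[of "4 * r", OF _ char] r by simp
  have md: "(a * R) mod (b * R) = (a mod b) * R" for a b by (rule mod_mult_mult2)
  have CG: "carrier ?G = {0..<8 * R}" and CK: "carrier ?K = {0..<4 * R}"
    using r by (simp_all add: carrier_integer_mod_group R_def)
  have MG: "x \<otimes>\<^bsub>?G\<^esub> y = (x + y) mod (8 * R)" and MK: "x \<otimes>\<^bsub>?K\<^esub> y = (x + y) mod (4 * R)" for x y
    by (simp_all add: R_def)
  have IG: "x \<in> carrier ?G \<Longrightarrow> inv\<^bsub>?G\<^esub> x = (- x) mod (8 * R)"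
    and IK: "x \<in> carrier ?K \<Longrightarrow> inv\<^bsub>?K\<^esub> x = (- x) mod (4 * R)" for x
    by (simp_all add: R_def)
  have "card UK = CARD('f) * card (push ` UG)"
  proof (rule card_unitary_obstruction[of "2 * R"])
    show "2 * R \<in> carrier ?G" using R CG by simp
    show "inv\<^bsub>?K\<^esub> (2 * R mod int (4 * r)) = 2 * R mod int (4 * r)"
      using R CK md[of "-2" 4] by (simp add: IK flip: R_def)
    show "2 * R \<noteq> \<one>\<^bsub>?G\<^esub>" using R by simp
    fix g assume g: "g \<in> carrier ?G" "inv\<^bsub>?K\<^esub> (g mod int (4 * r)) = g mod int (4 * r)"
    let ?h = "g mod (4 * R)"
    have "?h \<in> carrier ?K" using CK R by simp
    then have h: "?h = 0 \<or> ?h = 2 * R"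
      using g(2) r integer_mod_group_inv_eq_self[of "2 * r" ?h] by (simp add: R_def)
    have "g = ?h \<or> g = ?h + 4 * R"
    proof (cases "g < 4 * R")
      case False
      then have "?h = g - 4 * R" using g(1) CG by (intro int_mod_pos_eq[of _ _ 1]) auto
      then show ?thesis by simp
    qed (use g(1) CG in simp)
    then have "g = 0 \<or> g = 2 * R \<or> g = 4 * R \<or> g = 6 * R" using h by auto
    then show "inv\<^bsub>?G\<^esub> g = g \<or> g = 2 * R \<or> g = inv\<^bsub>?G\<^esub> (2 * R)"
      using R CG md[of "-2" 8] md[of "-4" 8] by (auto simp: IG simp del: inv_integer_mod_group)
  next
    fix g h assume "g \<in> carrier ?K" "h \<in> carrier ?K"
    then show "g \<otimes>\<^bsub>?K\<^esub> h = h \<otimes>\<^bsub>?K\<^esub> g" by (simp add: add.commute)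
  next
    fix a :: 'f
    \<comment> \<open>With g a generator of the large group, the witness for the value a is u = 1 +
      b (g^r + g^(3r)). In the quotient g^r has order 4 and all unwanted terms cancel in pairs, so
      the image is unitary. Upstairs g^r has order 8, and g^(2r) arises only from g^(3r) times the
      inverse of g^r, with coefficient b b = a.\<close>
    obtain b where b: "b * b = a" using char_two_square_surj[OF char] by blast
    define u where "u = sgl 0 1 + sgl R b + sgl (3 * R) b"
    have u: "u \<in> ga ?G" unfolding u_def using R CG by (intro G.add_in_ga G.sgl_in_ga) auto
    have su: "star ?G u = sgl 0 1 + sgl (7 * R) b + sgl (5 * R) b"
      using R CG md[of "-1" 8] md[of "-3" 8] by (simp add: u_def G.star_add G.star_sgl IG del: inv_integer_mod_group)
    have "u \<star>\<^bsub>?G\<^esub> star ?G u = sgl 0 1 + sgl (7 * R) b + sgl (5 * R) b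
        + (sgl R b + sgl 0 a + sgl (6 * R) a) + (sgl (3 * R) b + sgl (2 * R) a + sgl 0 a)"
      unfolding su unfolding u_def using R CG md[of 8 8] md[of 10 8]
      by (simp add: G.conv_add_left G.conv_add_right G.sgl_conv_sgl MG b mult.commute[of R 2] del: mult_integer_mod_group)
    then have "(u \<star>\<^bsub>?G\<^esub> star ?G u) (2 * R) = a" using R by (simp add: sgl_def)
    moreover have "push u \<in> UK"
    proof -
      have v: "push u = sgl 0 1 + sgl R b + sgl (3 * R) b"
      proof -
        have "0 \<in> carrier ?G" "R \<in> carrier ?G" "3 * R \<in> carrier ?G" using R CG by simp_all
        then show ?thesis
          unfolding u_def push_add by (simp only: push_sgl) (use R in \<open>simp flip: R_def\<close>)
      qed
      have sv: "star ?K (push u) = sgl 0 1 + sgl (3 * R) b + sgl R b"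
        unfolding v using R CK md[of "-1" 4] md[of "-3" 4] by (simp add: K.star_add K.star_sgl IK del: inv_integer_mod_group)
      have "push u \<star>\<^bsub>?K\<^esub> star ?K (push u) = sgl 0 1 + sgl (3 * R) b + sgl R b
          + (sgl R b + sgl 0 a + sgl (2 * R) a) + (sgl (3 * R) b + sgl (2 * R) a + sgl 0 a)"
        unfolding sv unfolding v using R CK md[of 4 4] md[of 6 4]
        by (simp add: K.conv_add_left K.conv_add_right K.sgl_conv_sgl MK b mult.commute[of R 2] del: mult_integer_mod_group)
      also have "\<dots> = sgl \<one>\<^bsub>?K\<^esub> 1"
        by (simp only: ac_simps add_self add_self_left add_0_left add_0_right one_integer_mod_group)
      finally show ?thesis unfolding UK_eq using push_in_ga[of u] by blast
    qed
    ultimately show "\<exists>u \<in> ga ?G. push u \<in> UK \<and> (u \<star>\<^bsub>?G\<^esub> star ?G u) (2 * R) = a"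
      using u by blast
  qed
  \<comment> \<open>Here 2r + 1 is half of 4r + 2, the exponent of the fiber size given by
    \<open>card_unitary\<close>.\<close>
  then have "CARD('f) ^ (2 * r + 1) * card UK = CARD('f) * (CARD('f) ^ (2 * r + 1) * card (push ` UG))"
    by (simp only: mult.left_commute)
  moreover have "card UG = CARD('f) ^ (2 * r + 1) * card (push ` UG)"
    using card_unitary r order_integer_mod_group[of "4 * r"] card_square_one_integer_mod_group[of "2 * r"]
    by simp
  ultimately have UK_UG: "CARD('f) ^ (2 * r + 1) * card UK = CARD('f) * card UG" by simp
  have K': "card UK * CARD('f) = 2 * CARD('f) ^ (2 * r + 1)"
    using K r order_integer_mod_group[of "4 * r"] card_square_one_integer_mod_group[of "2 * r"]
    by (simp add: unitary_formula_def)
  have "card UG * CARD('f) * CARD('f) = CARD('f) ^ (2 * r + 1) * (card UK * CARD('f))"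
    using UK_UG by (simp only: mult.assoc[symmetric]) (simp only: mult.commute)
  also have "\<dots> = 2 * CARD('f) ^ (4 * r + 1) * CARD('f)"
    unfolding K' using power_add[of "CARD('f)" "2 * r + 1" "2 * r + 1"] by (simp add: mult_2[symmetric])
  finally have "card UG * CARD('f) = 2 * CARD('f) ^ (4 * r + 1)" by simp
  then show ?thesis
    using r order_integer_mod_group[of "8 * r"] card_square_one_integer_mod_group[of "4 * r"]
    by (simp add: unitary_formula_def)
qed

text \<open>The induction starts at order 4 because the formula fails for order 2: there the
  involution is trivial and the unitary units are the |F| elements of augmentation 1, not 2
  |F|.\<close>

lemma unitary_formula_cyclic:
  assumes "2 \<le> m" "CHAR('f::{field,finite}) = 2"
  shows "unitary_formula (integer_mod_group (2 ^ m)) TYPE('f)"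
  using assms(1)
proof (induction m rule: nat_induct_at_least)
  case base
  then show ?case using unitary_formula_cyclic_4[OF assms(2)] by simp
next
  case (Suc m)
  have "(2::nat) ^ m = 4 * 2 ^ (m - 2)" "(2::nat) ^ Suc m = 8 * 2 ^ (m - 2)"
    using Suc.hyps power_add[of "2::nat" 2 "m - 2"] power_add[of "2::nat" 3 "m - 2"] by simp_all
  then show ?case using unitary_formula_cyclic_double[of "2 ^ (m - 2)"] Suc.IH assms(2) by simp
qed

text \<open>For the projection to the first factor the lifting criterion is immediate: the second
  component is always its own inverse.\<close>

lemma unitary_formula_cyclic_times_2:
  assumes "2 \<le> m" and char: "CHAR('f::{field,finite}) = 2"
  shows "unitary_formula (integer_mod_group (2 ^ m) \<times>\<times> integer_mod_group 2) TYPE('f)"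
proof -
  let ?K = "integer_mod_group (2 ^ m)" and ?B = "integer_mod_group 2"
  interpret K: finite_group ?K by (rule finite_group_integer_mod_group) simp
  interpret B: finite_group ?B by (rule finite_group_integer_mod_group) simp
  have CB: "carrier ?B = {0, 1}" by (auto simp: carrier_integer_mod_group)
  interpret G: group "?K \<times>\<times> ?B" by (rule DirProd_group) unfold_locales
  interpret double_cover "?K \<times>\<times> ?B" ?K fst "(0, 1)" "TYPE('f)"
  proof
    show "finite (carrier (?K \<times>\<times> ?B))" by (simp add: DirProd_def)
    show "fst \<in> hom (?K \<times>\<times> ?B) ?K" by (auto simp: hom_def)
    show "fst ` carrier (?K \<times>\<times> ?B) = carrier ?K" by (auto simp: DirProd_def CB)
    show "{g \<in> carrier (?K \<times>\<times> ?B). fst g = \<one>\<^bsub>?K\<^esub>} = {\<one>\<^bsub>?K \<times>\<times> ?B\<^esub>, (0, 1)}"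
      using K.one_closed by (auto simp: CB)
    show "(0, 1) \<noteq> \<one>\<^bsub>?K \<times>\<times> ?B\<^esub>" by simp
  qed (fact char)
  show ?thesis
  proof (rule unitary_formula_lift)
    fix g assume g: "g \<in> carrier (?K \<times>\<times> ?B)" "inv\<^bsub>?K\<^esub> fst g = fst g"
    moreover have "inv\<^bsub>?B\<^esub> snd g = snd g" using g CB by auto
    ultimately show "inv\<^bsub>?K \<times>\<times> ?B\<^esub> g = g"
      using inv_DirProd[OF K.is_group B.is_group] by (cases g) auto
  qed (rule unitary_formula_cyclic[OF assms])
qed

section \<open>The group \<open>H\<close>\<close>

definition word_class :: "('a word \<times> 'a word) set \<Rightarrow> 'a word \<Rightarrow> 'a word set" where
  "word_class R u = {w. word_eq R u w}"

lemma word_class_eq_iff: "word_class R u = word_class R v \<longleftrightarrow> word_eq R u v"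
  unfolding word_class_def by (auto intro: word_eq.refl word_eq.sym word_eq.trans)

lemma carrier_presented_group: "carrier (presented_group R) = range (word_class R)"
  by (auto simp: presented_group_def quotient_def word_class_def)

lemma one_presented_group: "\<one>\<^bsub>presented_group R\<^esub> = word_class R []"
  by (simp add: presented_group_def word_class_def)

lemma mult_presented_group:
  "word_class R u \<otimes>\<^bsub>presented_group R\<^esub> word_class R v = word_class R (u @ v)"
  by (auto simp: presented_group_def word_class_def
      intro: word_eq.refl word_eq.append word_eq.sym word_eq.trans)

lemma word_eq_word_inv: "word_eq R (word_inv w @ w) []"
proof (induction w)
  case Nil
  show ?case by (simp add: word_inv_def word_eq.refl)
next
  case (Cons l w)
  obtain x e where l: "l = (x, e)" by (cases l)
  have "word_eq R ([(x, \<not> e), (x, e)] @ w) ([] @ w)"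
    using word_eq.cancel[of R x "\<not> e"] by (intro word_eq.append) (simp_all add: word_eq.refl)
  then have "word_eq R (word_inv w @ ([(x, \<not> e), (x, e)] @ w)) (word_inv w @ w)"
    by (intro word_eq.append) (simp_all add: word_eq.refl)
  then show ?case using Cons.IH word_eq.trans by (fastforce simp: l word_inv_def)
qed

lemma group_presented_group: "group (presented_group R)"
proof (rule groupI)
  fix x assume "x \<in> carrier (presented_group R)"
  then obtain w where w: "x = word_class R w" by (auto simp: carrier_presented_group)
  have "word_class R (word_inv w) \<otimes>\<^bsub>presented_group R\<^esub> x = \<one>\<^bsub>presented_group R\<^esub>"
    by (simp add: w mult_presented_group one_presented_group word_class_eq_iff word_eq_word_inv)
  then show "\<exists>y\<in>carrier (presented_group R). y \<otimes>\<^bsub>presented_group R\<^esub> x = \<one>\<^bsub>presented_group R\<^esub>"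
    by (auto simp: carrier_presented_group)
qed (auto simp: carrier_presented_group one_presented_group mult_presented_group)

text \<open>
  The exponents \<open>(i, j, k)\<close> of the normal form \<open>a\<^sup>i b\<^sup>j c\<^sup>k\<close>, not reduced modulo the orders
  \<open>N, 2, 2\<close> of the generators; a letter \<open>x\<^sup>-\<^sup>1\<close> is counted as \<open>x\<^sup>N\<^sup>-\<^sup>1\<close> or as \<open>x\<close> accordingly.
  Moving \<open>b\<close> to the right across \<open>a\<^sup>i\<close> produces \<open>c\<^sup>i\<close>.
\<close>

fun H_exponents :: "nat \<Rightarrow> H_gen word \<Rightarrow> nat \<times> nat \<times> nat" where
  "H_exponents N [] = (0, 0, 0)"
| "H_exponents N ((x, e) # w) = (case H_exponents N w of (i, j, k) \<Rightarrow>
     (case x of GenA \<Rightarrow> (if e then i + 1 else i + (N - 1), j, k)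
      | GenB \<Rightarrow> (i, j + 1, k + i)
      | GenC \<Rightarrow> (i, j, k + 1)))"

text \<open>The product of two words in normal form, on unreduced exponents: b^j moved to the right
  across a^i' leaves c^(j i').\<close>

definition H_mult :: "nat \<times> nat \<times> nat \<Rightarrow> nat \<times> nat \<times> nat \<Rightarrow> nat \<times> nat \<times> nat" where
  "H_mult = (\<lambda>(i, j, k) (i', j', k'). (i + i', j + j', k + k' + j * i'))"

definition H_reduce :: "nat \<Rightarrow> nat \<times> nat \<times> nat \<Rightarrow> nat \<times> nat \<times> nat" where
  "H_reduce N = (\<lambda>(i, j, k). (i mod N, j mod 2, k mod 2))"

lemma H_exponents_append: "H_exponents N (u @ v) = H_mult (H_exponents N u) (H_exponents N v)"
proof (induction u)
  case Nil
  show ?case by (simp add: H_mult_def split: prod.split)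
next
  case (Cons l u)
  then show ?case
    by (cases l; cases "fst l") (auto simp: H_mult_def algebra_simps split: prod.splits)
qed

text \<open>The only delicate entry is the product j i' in the exponent of c: i' is known modulo N
  but needed modulo 2, which is why N has to be even.\<close>

lemma H_reduce_mult_cong:
  assumes N: "even N" and eq: "H_reduce N s = H_reduce N s'" "H_reduce N t = H_reduce N t'"
  shows "H_reduce N (H_mult s t) = H_reduce N (H_mult s' t')"
proof -
  obtain i j k i' j' k' where s: "s = (i, j, k)" "s' = (i', j', k')" by (cases s, cases s') auto
  obtain l m n l' m' n' where t: "t = (l, m, n)" "t' = (l', m', n')" by (cases t, cases t') auto
  have l: "l mod N = l' mod N" using eq by (simp add: t H_reduce_def)
  then have l2: "l mod 2 = l' mod 2" using N by (metis mod_mod_cancel)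
  have m: "j mod 2 = j' mod 2" "i mod N = i' mod N" "k mod 2 = k' mod 2" "m mod 2 = m' mod 2" "n mod 2 = n' mod 2"
    using eq by (simp_all add: s t H_reduce_def)
  have "(k + n + j * l) mod 2 = (k' + n' + j' * l') mod 2"
    by (rule mod_add_cong[OF mod_add_cong[OF m(3) m(5)] mod_mult_cong[OF m(1) l2]])
  moreover have "(i + l) mod N = (i' + l') mod N" "(j + m) mod 2 = (j' + m') mod 2"
    by (rule mod_add_cong[OF m(2) l], rule mod_add_cong[OF m(1) m(4)])
  ultimately show ?thesis by (simp add: s t H_reduce_def H_mult_def)
qed

lemma H_exponents_replicate:
  "H_exponents N (replicate i (GenA, True) @ replicate j (GenB, True) @ replicate k (GenC, True)) = (i, j, k)"
proof -
  have "H_exponents N (replicate i (GenA, True)) = (i, 0, 0)" for i by (induction i) auto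
  moreover have "H_exponents N (replicate j (GenB, True)) = (0, j, 0)" for j by (induction j) auto
  moreover have "H_exponents N (replicate k (GenC, True)) = (0, 0, k)" for k by (induction k) auto
  ultimately show ?thesis by (simp add: H_exponents_append H_mult_def)
qed

text \<open>The reduced exponents are an invariant of the congruence, checked on cancellations and
  defining relations. This shows that the presentation does not collapse: words with different
  reduced normal forms represent different elements.\<close>

lemma word_eq_H_exponents:
  assumes n: "3 \<le> n" and eq: "word_eq (H_relations n) u v"
  defines "N \<equiv> 2 ^ (n - 2)"
  shows "H_reduce N (H_exponents N u) = H_reduce N (H_exponents N v)"
  using eq
proof induction
  case (append u u' v v')
  have "even N" using n by (simp add: N_def)
  then show ?case
    unfolding H_exponents_append by (rule H_reduce_mult_cong) (fact append.IH)+
next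
  case (cancel x e)
  have "0 < N" by (simp add: N_def)
  then show ?case by (cases x; cases e) (simp_all add: H_reduce_def)
next
  case (relation l r)
  have N: "0 < N" by (simp add: N_def)
  have "H_exponents N (concat (replicate i [(GenA, True)])) = (i, 0, 0)" for i
    by (induction i) auto
  then show ?case
    using relation N unfolding H_relations_def N_def[symmetric]
    by (auto simp: H_reduce_def word_comm_def word_inv_def Let_def)
qed auto

section \<open>The normal form in H and equality of its elements\<close>

locale H_presentation =
  fixes n :: nat and N :: nat
  assumes n: "4 \<le> n"
  defines "N \<equiv> 2 ^ (n - 2)"
begin

abbreviation "H \<equiv> H_group n"
abbreviation "cls \<equiv> word_class (H_relations n)"
abbreviation "gen x \<equiv> cls [(x, True)]"

sublocale group H
  unfolding H_group_def by (rule group_presented_group)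

lemma carrier_H: "carrier H = range cls"
  by (simp add: H_group_def carrier_presented_group)

lemma cls_closed [simp]: "cls w \<in> carrier H"
  by (simp add: carrier_H)

lemma cls_append: "cls (u @ v) = cls u \<otimes>\<^bsub>H\<^esub> cls v"
  by (simp add: H_group_def mult_presented_group)

lemma cls_Nil: "cls [] = \<one>\<^bsub>H\<^esub>"
  by (simp add: H_group_def one_presented_group)

lemma cls_relation: "(l, r) \<in> H_relations n \<Longrightarrow> cls l = cls r"
  by (simp add: word_class_eq_iff word_eq.relation)

lemma cls_inverse: "cls [(x, False)] = inv\<^bsub>H\<^esub> gen x"
proof (rule inv_equality[symmetric])
  show "cls [(x, False)] \<otimes>\<^bsub>H\<^esub> gen x = \<one>\<^bsub>H\<^esub>"
    using word_eq.cancel[of "H_relations n" x False]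
    by (simp add: cls_append[symmetric] cls_Nil[symmetric] word_class_eq_iff)
qed simp_all

lemma cls_word_inv: "cls (word_inv w) = inv\<^bsub>H\<^esub> cls w"
proof (rule inv_equality[symmetric])
  show "cls (word_inv w) \<otimes>\<^bsub>H\<^esub> cls w = \<one>\<^bsub>H\<^esub>"
    by (simp add: cls_append[symmetric] cls_Nil[symmetric] word_class_eq_iff word_eq_word_inv)
qed simp_all

lemma a_pow: "gen GenA [^]\<^bsub>H\<^esub> N = \<one>\<^bsub>H\<^esub>"
proof -
  have "cls (replicate i (GenA, True)) = gen GenA [^]\<^bsub>H\<^esub> i" for i
  proof (induction i)
    case (Suc i)
    have "cls (replicate (Suc i) (GenA, True)) = gen GenA \<otimes>\<^bsub>H\<^esub> gen GenA [^]\<^bsub>H\<^esub> i"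
      using cls_append[of "[(GenA, True)]" "replicate i (GenA, True)"] by (simp add: Suc)
    then show ?case using nat_pow_Suc2[of "gen GenA"] by simp
  qed (simp add: cls_Nil)
  moreover have "(replicate N (GenA, True), []) \<in> H_relations n"
    by (simp add: H_relations_def Let_def N_def)
  ultimately show ?thesis using cls_relation[of "replicate N (GenA, True)" "[]"] cls_Nil by simp
qed

lemma b_square: "gen GenB \<otimes>\<^bsub>H\<^esub> gen GenB = \<one>\<^bsub>H\<^esub>"
  and c_square: "gen GenC \<otimes>\<^bsub>H\<^esub> gen GenC = \<one>\<^bsub>H\<^esub>"
  unfolding cls_append[symmetric] cls_Nil[symmetric]
  by (rule cls_relation; simp add: H_relations_def Let_def)+

lemma commute_if_word_comm:
  assumes "cls (word_comm u v) = z"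
  shows "cls v \<otimes>\<^bsub>H\<^esub> cls u \<otimes>\<^bsub>H\<^esub> z = cls u \<otimes>\<^bsub>H\<^esub> cls v"
proof -
  have "z = inv\<^bsub>H\<^esub> cls u \<otimes>\<^bsub>H\<^esub> (inv\<^bsub>H\<^esub> cls v \<otimes>\<^bsub>H\<^esub> (cls u \<otimes>\<^bsub>H\<^esub> cls v))"
    unfolding assms[symmetric] word_comm_def cls_append cls_word_inv ..
  then have "z = inv\<^bsub>H\<^esub> (cls v \<otimes>\<^bsub>H\<^esub> cls u) \<otimes>\<^bsub>H\<^esub> (cls u \<otimes>\<^bsub>H\<^esub> cls v)"
    by (simp add: inv_mult_group m_assoc)
  then show ?thesis by (simp add: m_assoc[symmetric])
qed

lemma c_a: "gen GenC \<otimes>\<^bsub>H\<^esub> gen GenA = gen GenA \<otimes>\<^bsub>H\<^esub> gen GenC"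
  and c_b: "gen GenC \<otimes>\<^bsub>H\<^esub> gen GenB = gen GenB \<otimes>\<^bsub>H\<^esub> gen GenC"
proof -
  have "cls (word_comm [(GenA, True)] [(GenC, True)]) = \<one>\<^bsub>H\<^esub>"
    "cls (word_comm [(GenB, True)] [(GenC, True)]) = \<one>\<^bsub>H\<^esub>"
    unfolding cls_Nil[symmetric] by (rule cls_relation; simp add: H_relations_def Let_def)+
  from this[THEN commute_if_word_comm] show
    "gen GenC \<otimes>\<^bsub>H\<^esub> gen GenA = gen GenA \<otimes>\<^bsub>H\<^esub> gen GenC"
    "gen GenC \<otimes>\<^bsub>H\<^esub> gen GenB = gen GenB \<otimes>\<^bsub>H\<^esub> gen GenC"
    by simp_all
qed

lemma b_a: "gen GenB \<otimes>\<^bsub>H\<^esub> gen GenA = gen GenA \<otimes>\<^bsub>H\<^esub> (gen GenB \<otimes>\<^bsub>H\<^esub> gen GenC)"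
proof -
  have "cls (word_comm [(GenA, True)] [(GenB, True)]) = gen GenC"
    by (rule cls_relation) (simp add: H_relations_def Let_def)
  from commute_if_word_comm[OF this]
  have "gen GenB \<otimes>\<^bsub>H\<^esub> gen GenA \<otimes>\<^bsub>H\<^esub> gen GenC \<otimes>\<^bsub>H\<^esub> gen GenC
    = gen GenA \<otimes>\<^bsub>H\<^esub> gen GenB \<otimes>\<^bsub>H\<^esub> gen GenC" by simp
  then show ?thesis by (simp add: m_assoc c_square)
qed

definition nf :: "nat \<times> nat \<times> nat \<Rightarrow> H_gen word set" where
  "nf = (\<lambda>(i, j, k). gen GenA [^]\<^bsub>H\<^esub> i \<otimes>\<^bsub>H\<^esub> (gen GenB [^]\<^bsub>H\<^esub> j \<otimes>\<^bsub>H\<^esub> gen GenC [^]\<^bsub>H\<^esub> k))"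

lemma pow_commute_left:
  assumes "x \<in> carrier H" "y \<in> carrier H" "z \<in> carrier H" "y \<otimes>\<^bsub>H\<^esub> x = x \<otimes>\<^bsub>H\<^esub> y"
  shows "y \<otimes>\<^bsub>H\<^esub> (x [^]\<^bsub>H\<^esub> (i::nat) \<otimes>\<^bsub>H\<^esub> z) = x [^]\<^bsub>H\<^esub> i \<otimes>\<^bsub>H\<^esub> (y \<otimes>\<^bsub>H\<^esub> z)"
proof -
  have "x [^]\<^bsub>H\<^esub> i \<otimes>\<^bsub>H\<^esub> y = y \<otimes>\<^bsub>H\<^esub> x [^]\<^bsub>H\<^esub> i"
    using assms by (intro group_commutes_pow) simp_all
  then show ?thesis using assms by (metis m_assoc nat_pow_closed)
qed

lemma b_a_pow: "gen GenB \<otimes>\<^bsub>H\<^esub> gen GenA [^]\<^bsub>H\<^esub> (i::nat)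
    = gen GenA [^]\<^bsub>H\<^esub> i \<otimes>\<^bsub>H\<^esub> (gen GenB \<otimes>\<^bsub>H\<^esub> gen GenC [^]\<^bsub>H\<^esub> i)"
proof (induction i)
  case (Suc i)
  let ?a = "gen GenA" and ?b = "gen GenB" and ?c = "gen GenC"
  have "?b \<otimes>\<^bsub>H\<^esub> ?a [^]\<^bsub>H\<^esub> Suc i = ?b \<otimes>\<^bsub>H\<^esub> ?a [^]\<^bsub>H\<^esub> i \<otimes>\<^bsub>H\<^esub> ?a" by (simp add: m_assoc)
  also have "\<dots> = ?a [^]\<^bsub>H\<^esub> i \<otimes>\<^bsub>H\<^esub> (?b \<otimes>\<^bsub>H\<^esub> (?c [^]\<^bsub>H\<^esub> i \<otimes>\<^bsub>H\<^esub> ?a))" by (simp add: Suc m_assoc)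
  also have "?c [^]\<^bsub>H\<^esub> i \<otimes>\<^bsub>H\<^esub> ?a = ?a \<otimes>\<^bsub>H\<^esub> ?c [^]\<^bsub>H\<^esub> i"
    by (rule group_commutes_pow) (simp_all add: c_a)
  also have "?b \<otimes>\<^bsub>H\<^esub> (?a \<otimes>\<^bsub>H\<^esub> ?c [^]\<^bsub>H\<^esub> i) = ?a \<otimes>\<^bsub>H\<^esub> (?b \<otimes>\<^bsub>H\<^esub> (?c \<otimes>\<^bsub>H\<^esub> ?c [^]\<^bsub>H\<^esub> i))"
    using b_a by (simp flip: m_assoc)
  also have "?c \<otimes>\<^bsub>H\<^esub> ?c [^]\<^bsub>H\<^esub> i = ?c [^]\<^bsub>H\<^esub> Suc i" by (rule nat_pow_Suc2[symmetric]) simp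
  finally show ?case by (simp add: m_assoc[symmetric] del: nat_pow_Suc)
qed simp

text \<open>Every word can be rewritten to its normal form using the relations: letters are absorbed
  from the left, where the inverse of a is a^(N-1) and b, c are their own inverses, in accordance
  with \<open>H_exponents\<close>.\<close>

lemma cls_eq_nf: "cls w = nf (H_exponents N w)"
proof (induction w)
  case Nil
  show ?case by (simp add: cls_Nil nf_def)
next
  case (Cons l w)
  let ?a = "gen GenA" and ?b = "gen GenB" and ?c = "gen GenC"
  obtain x e where l: "l = (x, e)" by (cases l)
  obtain i j k where w: "H_exponents N w = (i, j, k)" by (cases "H_exponents N w")
  have a: "cls [(GenA, e)] = ?a [^]\<^bsub>H\<^esub> (if e then 1 else N - 1)"
  proof (cases e)
    case False
    have "?a [^]\<^bsub>H\<^esub> (N - 1) \<otimes>\<^bsub>H\<^esub> ?a = \<one>\<^bsub>H\<^esub>"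
      using a_pow nat_pow_Suc[of ?a "N - 1"] by (simp add: N_def)
    then show ?thesis using False inv_equality[of "?a [^]\<^bsub>H\<^esub> (N - 1)" ?a] by (simp add: cls_inverse)
  qed simp
  have b: "cls [(GenB, e)] = ?b" and c: "cls [(GenC, e)] = ?c"
    using inv_equality[OF b_square] inv_equality[OF c_square]
    by (cases e; simp add: cls_inverse)+
  have "cls (l # w) = cls [l] \<otimes>\<^bsub>H\<^esub> nf (i, j, k)"
    using cls_append[of "[l]" w] Cons w by simp
  also have "\<dots> = nf (H_exponents N (l # w))"
  proof (cases x)
    case GenA
    have "?a [^]\<^bsub>H\<^esub> m \<otimes>\<^bsub>H\<^esub> nf (i, j, k) = nf (i + m, j, k)" for m :: nat
      by (simp add: nf_def nat_pow_mult add.commute flip: m_assoc)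
    then show ?thesis unfolding l GenA a by (simp add: w)
  next
    case GenB
    have "?b \<otimes>\<^bsub>H\<^esub> nf (i, j, k)
      = ?a [^]\<^bsub>H\<^esub> i \<otimes>\<^bsub>H\<^esub> (?b \<otimes>\<^bsub>H\<^esub> (?c [^]\<^bsub>H\<^esub> i \<otimes>\<^bsub>H\<^esub> (?b [^]\<^bsub>H\<^esub> j \<otimes>\<^bsub>H\<^esub> ?c [^]\<^bsub>H\<^esub> k)))"
      using b_a_pow[of i] by (simp add: nf_def m_assoc flip: m_assoc[of ?b "?a [^]\<^bsub>H\<^esub> i"])
    also have "?c [^]\<^bsub>H\<^esub> i \<otimes>\<^bsub>H\<^esub> (?b [^]\<^bsub>H\<^esub> j \<otimes>\<^bsub>H\<^esub> ?c [^]\<^bsub>H\<^esub> k)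
      = ?b [^]\<^bsub>H\<^esub> j \<otimes>\<^bsub>H\<^esub> (?c [^]\<^bsub>H\<^esub> i \<otimes>\<^bsub>H\<^esub> ?c [^]\<^bsub>H\<^esub> k)"
      by (intro pow_commute_left) (simp_all add: group_commutes_pow c_b)
    also have "?c [^]\<^bsub>H\<^esub> i \<otimes>\<^bsub>H\<^esub> ?c [^]\<^bsub>H\<^esub> k = ?c [^]\<^bsub>H\<^esub> (k + i)"
      by (simp add: nat_pow_mult add.commute)
    also have "?b \<otimes>\<^bsub>H\<^esub> (?b [^]\<^bsub>H\<^esub> j \<otimes>\<^bsub>H\<^esub> ?c [^]\<^bsub>H\<^esub> (k + i)) = ?b [^]\<^bsub>H\<^esub> (j + 1) \<otimes>\<^bsub>H\<^esub> ?c [^]\<^bsub>H\<^esub> (k + i)"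
      using nat_pow_Suc2[of ?b j] by (simp flip: m_assoc)
    finally show ?thesis using b by (simp add: l GenB w nf_def)
  next
    case GenC
    have "?c \<otimes>\<^bsub>H\<^esub> nf (i, j, k) = ?a [^]\<^bsub>H\<^esub> i \<otimes>\<^bsub>H\<^esub> (?b [^]\<^bsub>H\<^esub> j \<otimes>\<^bsub>H\<^esub> (?c \<otimes>\<^bsub>H\<^esub> ?c [^]\<^bsub>H\<^esub> k))"
      by (simp add: nf_def pow_commute_left c_a c_b)
    also have "?c \<otimes>\<^bsub>H\<^esub> ?c [^]\<^bsub>H\<^esub> k = ?c [^]\<^bsub>H\<^esub> (k + 1)"
      using nat_pow_Suc2[of ?c k] by simp
    finally show ?thesis using c by (simp add: l GenC w nf_def)
  qed
  finally show ?case .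
qed

lemma nf_reduce: "nf (H_reduce N t) = nf t"
proof -
  have "x [^]\<^bsub>H\<^esub> (i mod m) = x [^]\<^bsub>H\<^esub> i" if "x \<in> carrier H" "x [^]\<^bsub>H\<^esub> m = \<one>\<^bsub>H\<^esub>" for x and i m :: nat
  proof -
    have "x [^]\<^bsub>H\<^esub> i = x [^]\<^bsub>H\<^esub> (m * (i div m)) \<otimes>\<^bsub>H\<^esub> x [^]\<^bsub>H\<^esub> (i mod m)"
      using that by (simp add: nat_pow_mult)
    then show ?thesis using that by (simp flip: nat_pow_pow)
  qed
  then show ?thesis
    using a_pow b_square c_square
    by (auto simp: nf_def H_reduce_def numeral_2_eq_2 split: prod.split)
qed

text \<open>Solution of the word problem: one direction is the invariance of the reduced exponents,
  the other the rewriting to normal form. Questions about H become arithmetic with triples.\<close>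

lemma cls_eq_iff: "cls u = cls v \<longleftrightarrow> H_reduce N (H_exponents N u) = H_reduce N (H_exponents N v)"
proof
  assume "cls u = cls v"
  then show "H_reduce N (H_exponents N u) = H_reduce N (H_exponents N v)"
    using word_eq_H_exponents[of n u v] n by (simp add: word_class_eq_iff N_def)
next
  assume "H_reduce N (H_exponents N u) = H_reduce N (H_exponents N v)"
  then show "cls u = cls v" using nf_reduce cls_eq_nf by metis
qed

lemma finite_carrier_H: "finite (carrier H)"
proof -
  have N: "0 < N" by (simp add: N_def)
  have "carrier H \<subseteq> nf ` ({..<N} \<times> {..<2} \<times> {..<2})"
  proof
    fix x assume "x \<in> carrier H"
    then obtain w where "x = nf (H_reduce N (H_exponents N w))"
      using nf_reduce cls_eq_nf by (auto simp: carrier_H)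
    moreover have "H_reduce N t \<in> {..<N} \<times> {..<2} \<times> {..<2}" for t
      using N by (auto simp: H_reduce_def split: prod.split)
    ultimately show "x \<in> nf ` ({..<N} \<times> {..<2} \<times> {..<2})" by blast
  qed
  then show ?thesis using finite_surj by (metis finite_SigmaI finite_lessThan)
qed

text \<open>The projection of H onto its quotient by the commutator subgroup generated by c. A
  representing word is chosen arbitrarily; by \<open>ab_part_cls\<close> the choice does not
  matter.\<close>

definition ab_part :: "H_gen word set \<Rightarrow> int \<times> int" where
  "ab_part x = (case H_exponents N (SOME w. cls w = x) of (i, j, k) \<Rightarrow> (int (i mod N), int (j mod 2)))"

lemma ab_part_cls:
  assumes w: "H_exponents N w = (i, j, k)"
  shows "ab_part (cls w) = (int (i mod N), int (j mod 2))"
proof -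
  have "cls (SOME w'. cls w' = cls w) = cls w" by (rule someI) (rule HOL.refl)
  then have "H_reduce N (H_exponents N (SOME w'. cls w' = cls w)) = H_reduce N (i, j, k)"
    by (simp add: cls_eq_iff w)
  then show ?thesis by (auto simp: ab_part_def H_reduce_def split: prod.splits)
qed

abbreviation "K \<equiv> integer_mod_group N \<times>\<times> integer_mod_group 2"

lemma double_cover_H:
  assumes char: "CHAR('f::{field,finite}) = 2"
  shows "double_cover TYPE('f) H K ab_part (gen GenC)"
proof -
  have N: "0 < N" by (simp add: N_def)
  interpret A: finite_group "integer_mod_group N" by (rule finite_group_integer_mod_group) (rule N)
  interpret B: finite_group "integer_mod_group 2" by (rule finite_group_integer_mod_group) simp
  interpret K: group K by (rule DirProd_group) unfold_locales
  have KC: "carrier K = {0..<int N} \<times> {0..<2}" using N by (auto simp: carrier_integer_mod_group)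
  have closed: "ab_part x \<in> carrier K" if x: "x \<in> carrier H" for x
  proof -
    obtain w where w: "x = cls w" using x by (auto simp: carrier_H)
    show ?thesis unfolding w KC using N
      by (cases "H_exponents N w") (simp add: ab_part_cls)
  qed
  show ?thesis
  proof
    show "finite (carrier H)" by (rule finite_carrier_H)
    show "finite (carrier K)" unfolding KC by simp
    show "ab_part \<in> hom H K"
    proof (rule homI)
      fix x y assume "x \<in> carrier H" "y \<in> carrier H"
      then obtain u v where uv: "x = cls u" "y = cls v" by (auto simp: carrier_H)
      obtain i j k where u: "H_exponents N u = (i, j, k)" by (cases "H_exponents N u")
      obtain i' j' k' where v: "H_exponents N v = (i', j', k')" by (cases "H_exponents N v")
      have "H_exponents N (u @ v) = (i + i', j + j', k + k' + j * i')"
        by (simp add: H_exponents_append u v H_mult_def)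
      then show "ab_part (x \<otimes>\<^bsub>H\<^esub> y) = ab_part x \<otimes>\<^bsub>K\<^esub> ab_part y"
        unfolding uv cls_append[symmetric]
        by (simp add: ab_part_cls[OF u] ab_part_cls[OF v] ab_part_cls mod_simps zmod_int)
    qed (rule closed)
    show "ab_part ` carrier H = carrier K"
    proof (intro equalityI subsetI)
      fix y assume y: "y \<in> carrier K"
      \<comment> \<open>The preimage is a^i b^j; the empty power of c gives it the shape of
        \<open>H_exponents_replicate\<close>.\<close>
      let ?w = "replicate (nat (fst y)) (GenA, True) @ replicate (nat (snd y)) (GenB, True)
        @ replicate 0 (GenC, True)"
      have "ab_part (cls ?w) = y"
        using y unfolding KC ab_part_cls[OF H_exponents_replicate] by (cases y) auto
      then show "y \<in> ab_part ` carrier H" by (metis cls_closed imageI)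
    qed (use closed in blast)
    show "{g \<in> carrier H. ab_part g = \<one>\<^bsub>K\<^esub>} = {\<one>\<^bsub>H\<^esub>, gen GenC}"
    proof (intro equalityI subsetI)
      fix x assume x: "x \<in> {g \<in> carrier H. ab_part g = \<one>\<^bsub>K\<^esub>}"
      then have "x \<in> range cls" unfolding carrier_H by blast
      then obtain w where w: "x = cls w" by blast
      obtain i j k where e: "H_exponents N w = (i, j, k)" by (cases "H_exponents N w")
      have ij: "i mod N = 0" "j mod 2 = 0" using x by (auto simp: w ab_part_cls[OF e])
      have "cls w = cls [] \<or> cls w = gen GenC"
        unfolding cls_eq_iff e using ij by (auto simp: H_reduce_def)
      then show "x \<in> {\<one>\<^bsub>H\<^esub>, gen GenC}" by (simp add: w cls_Nil)
    next
      fix x assume "x \<in> {\<one>\<^bsub>H\<^esub>, gen GenC}"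
      then show "x \<in> {g \<in> carrier H. ab_part g = \<one>\<^bsub>K\<^esub>}"
        by (auto simp: cls_Nil[symmetric] ab_part_cls[of _ 0 0 0] ab_part_cls[of _ 0 0 1])
    qed
    show "gen GenC \<noteq> \<one>\<^bsub>H\<^esub>"
      by (simp add: cls_Nil[symmetric] cls_eq_iff H_reduce_def)
  qed (fact char)
qed

text \<open>Let x = a^i b^j c^k lie over a self-inverse element, so that N divides 2 i. Since 4
  divides N, which is where n \<ge> 4 enters, i is even. The square of x has c-exponent 2 k + j i,
  which is then even, so x squares to one and the lifting criterion applies.\<close>

lemma unitary_formula_H:
  assumes char: "CHAR('f::{field,finite}) = 2"
  shows "unitary_formula H TYPE('f)"
proof -
  interpret double_cover H K ab_part "gen GenC" "TYPE('f)" by (rule double_cover_H[OF char])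
  have N4: "4 dvd N"
    using n le_imp_power_dvd[of 2 "n - 2" "2::nat"] by (simp add: N_def)
  show ?thesis
  proof (rule unitary_formula_lift)
    fix x assume x: "x \<in> carrier H" "inv\<^bsub>K\<^esub> ab_part x = ab_part x"
    then obtain w where w: "x = cls w" by (auto simp: carrier_H)
    obtain i j k where e: "H_exponents N w = (i, j, k)" by (cases "H_exponents N w")
    have ee: "H_exponents N (w @ w) = (i + i, j + j, k + k + j * i)"
      by (simp add: H_exponents_append e H_mult_def)
    have "ab_part x \<otimes>\<^bsub>K\<^esub> ab_part x = \<one>\<^bsub>K\<^esub>"
      using K.r_inv[of "ab_part x"] x p_closed by simp
    then have "ab_part (cls (w @ w)) = \<one>\<^bsub>K\<^esub>"
      using x w by (simp add: cls_append)
    then have ii: "(i + i) mod N = 0" by (simp add: ab_part_cls[OF ee])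
    then have "4 dvd i + i" using N4 by (meson dvd_trans mod_0_imp_dvd)
    then have "even i" by presburger
    then have "cls (w @ w) = cls []"
      unfolding cls_eq_iff ee using ii by (simp add: H_reduce_def)
    then have "x \<otimes>\<^bsub>H\<^esub> x = \<one>\<^bsub>H\<^esub>" by (simp add: w cls_append cls_Nil)
    then show "inv\<^bsub>H\<^esub> x = x" using x(1) by (intro inv_equality)
  next
    show "unitary_formula K TYPE('f)"
      using unitary_formula_cyclic_times_2[of "n - 2", OF _ char] n by (simp add: N_def)
  qed
qed

end

theorem corollary4:
  fixes n :: nat
    and G :: "H_gen word set monoid"
  assumes "n \<ge> 4"
    and "G = H_group n"
    and "CHAR('f::{field, finite}) = 2"
  shows "real (card (unitary_units G :: (H_gen word set \<Rightarrow> 'f) set)) =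
    2 * real CARD('f) powr
      (1 / 2 * (real (order G) + real (card (square_one_elements G))) - 1)"
proof -
  interpret H: H_presentation n "2 ^ (n - 2)"
    by unfold_locales (use assms(1) in simp_all)
  interpret finite_group G
    unfolding assms(2) using H.finite_carrier_H by unfold_locales
  let ?q = "real CARD('f)" and ?s = "order G + card (square_one_elements G)"
  have card: "card (unitary_units G :: (H_gen word set \<Rightarrow> 'f) set) * CARD('f) = 2 * CARD('f) ^ (?s div 2)"
    using H.unitary_formula_H[OF assms(3)] assms(2) by (simp add: unitary_formula_def)
  have "real (card (unitary_units G :: (H_gen word set \<Rightarrow> 'f) set)) * ?q = 2 * ?q ^ (?s div 2)"
    using arg_cong[OF card, of real] by (simp only: of_nat_mult of_nat_numeral of_nat_power)
  moreover have q: "?q > 0" by simp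
  \<comment> \<open>By parity the natural division is exact, so the real exponent of the claim is an
    integer minus one and the factor |F| can be divided out.\<close>
  moreover have e: "real (?s div 2) = 1 / 2 * (real (order G) + real (card (square_one_elements G)))"
    using even_order_add_card_square_one by (simp add: real_of_nat_div)
  have "?q ^ (?s div 2) = ?q powr (real (?s div 2) - 1) * ?q"
    using q by (simp add: powr_diff powr_realpow)
  ultimately show ?thesis unfolding e by simp
qed

end
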